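(* Let $T>0$, $\sigma\in\mathbb{R}$, $0<R\le 1$, and $\alpha(r)=\lambda e^{-\rho r}+(1-\lambda)e^{-\gamma r}$ with $\gamma>\rho>0$ and $\lambda\in(0,1)$. Let $P\in C(\Delta[0,T])$ be the unique continuous solution of $$\left\{\begin{aligned} & P_s(t,s)+2P(t,s)\big[\bar\Theta_1(s)+\bar\Theta_2(s)\big]+\sigma^2P(t,s)+\alpha(s-t)\big[-\bar\Theta_1(s)^2+R\,\bar\Theta_2(s)^2\big]=0,\quad (t,s)\in\Delta[0,T],\\ & P(t,T)=\alpha(T-t),\quad t\in[0,T], \end{aligned}\right.$$ where $\bar\Theta_1(s)=P(s,s)$ and $\bar\Theta_2(s)=-P(s,s)/R$ for $s\in[0,T]$. For each partition $\Pi$ of $[0,T]$ let $P^\Pi$ and $\bar\Theta_1^\Pi,\bar\Theta_2^\Pi$ be the functions associated with $\Pi$ as defined in the context. Then, as $\|\Pi\|\to0$, $P^\Pi(\cdot,\cdot)$ converges to $P(\cdot,\cdot)$ uniformly on $\Delta[0,T]$, and $\bar\Theta_i^\Pi(\cdot)$ converges to $\bar\Theta_i(\cdot)$ uniformly on $[0,T]$ for $i=1,2$.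
   Context: $\Delta[0,T]=\{(t,s)\in[0,T]^2: 0\le t\le s\le T\}$; the subscript $s$ denotes the partial derivative in the second variable. A partition $\Pi$ of $[0,T]$ is $0=t_0<t_1<\dots<t_{N-1}<t_N=T$, with mesh size $\|\Pi\|=\max_{i\ge1}(t_i-t_{i-1})$. Put $$\alpha^\Pi(t,s)=\alpha(s-t_{k-1}),\qquad t\in[t_{k-1},t_k),\ s\in[t,T],\ k=1,\dots,N,$$ with the last interval ($k=N$) taken closed, $t\in[t_{N-1},t_N]$. The functions $P^\Pi,\bar\Theta^\Pi_1,\bar\Theta^\Pi_2$ are defined by the system $$\bar\Theta_1^\Pi(s)=\frac{P^\Pi(s,s)}{\alpha^\Pi(s,s)},\qquad \bar\Theta_2^\Pi(s)=-\frac{P^\Pi(s,s)}{R\,\alpha^\Pi(s,s)},\qquad s\in[0,T],$$ $$\left\{\begin{aligned} &P^\Pi_s(t,s)+2P^\Pi(t,s)\big[\bar\Theta_1^\Pi(s)+\bar\Theta_2^\Pi(s)\big]+\sigma^2P^\Pi(t,s)+\alpha^\Pi(t,s)\big[-\bar\Theta_1^\Pi(s)^2+R\,\bar\Theta_2^\Pi(s)^2\big]=0,\quad (t,s)\in\Delta[0,T],\\ &P^\Pi(t,T)=\alpha^\Pi(t,T),\quad t\in[0,T]. \end{aligned}\right.$$ Equivalently, they are built by backward recursion on $k=N,N-1,\dots,1$: given $\bar\Theta_i^\Pi$ on $[t_k,T]$ (no data needed when $k=N$), let $P(t_{k-1};\cdot)$ be the continuous function on $[t_{k-1},T]$ with $P(t_{k-1};T)=\alpha(T-t_{k-1})$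 that solves the linear equation $$P_s(t_{k-1};s)+2P(t_{k-1};s)[\bar\Theta_1^\Pi(s)+\bar\Theta_2^\Pi(s)]+\sigma^2P(t_{k-1};s)+\alpha(s-t_{k-1})\big[-\bar\Theta_1^\Pi(s)^2+R\,\bar\Theta_2^\Pi(s)^2\big]=0,\quad s\in[t_k,T],$$ and then the Riccati equation $$P_s(t_{k-1};s)+\sigma^2P(t_{k-1};s)-\frac{1-R}{R\,\alpha(s-t_{k-1})}P(t_{k-1};s)^2=0,\quad s\in[t_{k-1},t_k];$$ set $\bar\Theta_1^\Pi(s)=\frac{P(t_{k-1};s)}{\alpha(s-t_{k-1})}$, $\bar\Theta_2^\Pi(s)=-\frac{P(t_{k-1};s)}{R\,\alpha(s-t_{k-1})}$ for $s\in[t_{k-1},t_k)$ (for $s\in[t_{N-1},T]$ when $k=N$), and $P^\Pi(t,s)=P(t_{k-1};s)$ for $t\in[t_{k-1},t_k)$ ($t\in[t_{N-1},T]$ when $k=N$) and $s\in[t,T]$. *)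

theory Defs
  imports "HOL-Analysis.Analysis"
begin

definition Delta :: "real \<Rightarrow> (real \<times> real) set" where
  "Delta T = {(t, s). 0 \<le> t \<and> t \<le> s \<and> s \<le> T}"

text \<open>
  The continuous problem. Derivatives in \<open>s\<close> are taken within \<open>[t, T]\<close>, hence are
  one-sided at the end points; at \<open>t = s = T\<close> the derivative condition is void.
\<close>

definition Theta1 :: "(real \<Rightarrow> real \<Rightarrow> real) \<Rightarrow> real \<Rightarrow> real" where
  "Theta1 P s = P s s"

definition Theta2 :: "real \<Rightarrow> (real \<Rightarrow> real \<Rightarrow> real) \<Rightarrow> real \<Rightarrow> real" where
  "Theta2 R P s = - P s s / R"

definition is_solution ::
  "real \<Rightarrow> real \<Rightarrow> real \<Rightarrow> (real \<Rightarrow> real) \<Rightarrow> (real \<Rightarrow> real \<Rightarrow> real) \<Rightarrow> bool" where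
  "is_solution T \<sigma> R \<alpha> P \<longleftrightarrow>
     continuous_on (Delta T) (\<lambda>(t, s). P t s) \<and>
     (\<forall>(t, s) \<in> Delta T. \<exists>P\<^sub>s.
        (P t has_real_derivative P\<^sub>s) (at s within {t..T}) \<and>
        P\<^sub>s + 2 * P t s * (Theta1 P s + Theta2 R P s) + \<sigma>\<^sup>2 * P t s
          + \<alpha> (s - t) * (- (Theta1 P s)\<^sup>2 + R * (Theta2 R P s)\<^sup>2) = 0) \<and>
     (\<forall>t\<in>{0..T}. P t T = \<alpha> (T - t))"

text \<open>
  A partition \<open>0 = t\<^sub>0 < \<dots> < t\<^sub>N = T\<close> is the list \<open>[t\<^sub>0, \<dots>, t\<^sub>N]\<close>. Cells are numbered from
  \<open>0\<close>, so cell \<open>k\<close> has left end point \<open>ts ! k\<close>; only the last cell is closed on the right.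
\<close>

definition is_partition :: "real \<Rightarrow> real list \<Rightarrow> bool" where
  "is_partition T ts \<longleftrightarrow> ts \<noteq> [] \<and> hd ts = 0 \<and> last ts = T \<and> sorted_wrt (<) ts"

definition mesh :: "real list \<Rightarrow> real" where
  "mesh ts = Max {ts ! Suc k - ts ! k | k. Suc k < length ts}"

definition mesh_to_zero :: "real \<Rightarrow> real list filter" where
  "mesh_to_zero T = inf (filtercomap mesh (at_right 0)) (principal {ts. is_partition T ts})"

lemma eventually_mesh_to_zero:
  "eventually Q (mesh_to_zero T) \<longleftrightarrow>
     (\<exists>\<delta>>0. \<forall>ts. is_partition T ts \<and> 0 < mesh ts \<and> mesh ts < \<delta> \<longrightarrow> Q ts)"
proof -
  have "eventually Q (mesh_to_zero T) \<longleftrightarrow>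
      (\<exists>S. eventually S (at_right (0::real)) \<and> (\<forall>ts. S (mesh ts) \<longrightarrow> is_partition T ts \<longrightarrow> Q ts))"
    by (simp add: mesh_to_zero_def eventually_inf_principal eventually_filtercomap)
  also have "\<dots> \<longleftrightarrow> (\<exists>\<delta>>0. \<forall>ts. is_partition T ts \<and> 0 < mesh ts \<and> mesh ts < \<delta> \<longrightarrow> Q ts)"
  proof safe
    fix S assume "eventually S (at_right (0::real))" and S: "\<forall>ts. S (mesh ts) \<longrightarrow> is_partition T ts \<longrightarrow> Q ts"
    then obtain \<delta> where "\<delta> > 0" "\<And>y. 0 < y \<Longrightarrow> y < \<delta> \<Longrightarrow> S y"
      unfolding eventually_at_right_field by auto
    with S show "\<exists>\<delta>>0. \<forall>ts. is_partition T ts \<and> 0 < mesh ts \<and> mesh ts < \<delta> \<longrightarrow> Q ts" by blast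
  next
    fix \<delta> :: real
    assume "\<delta> > 0" and Q: "\<forall>ts. is_partition T ts \<and> 0 < mesh ts \<and> mesh ts < \<delta> \<longrightarrow> Q ts"
    then show "\<exists>S. eventually S (at_right (0::real)) \<and> (\<forall>ts. S (mesh ts) \<longrightarrow> is_partition T ts \<longrightarrow> Q ts)"
      by (intro exI[of _ "\<lambda>y. 0 < y \<and> y < \<delta>"]) (auto simp: eventually_at_right_field)
  qed
  finally show ?thesis .
qed

definition cell :: "real list \<Rightarrow> nat \<Rightarrow> real set" where
  "cell ts k = (if Suc (Suc k) = length ts then {ts ! k..ts ! Suc k} else {ts ! k..<ts ! Suc k})"

definition cell_index :: "real list \<Rightarrow> real \<Rightarrow> nat" where
  "cell_index ts t = (THE k. Suc k < length ts \<and> t \<in> cell ts k)"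

definition alpha_part :: "(real \<Rightarrow> real) \<Rightarrow> real list \<Rightarrow> real \<Rightarrow> real \<Rightarrow> real" where
  "alpha_part \<alpha> ts t s = \<alpha> (s - ts ! cell_index ts t)"

text \<open>
  The backward recursion. A family \<open>p\<close> of rows represents \<open>P(t\<^sub>k; s)\<close> as \<open>p k s\<close>, for
  \<open>s \<in> [t\<^sub>k, T]\<close>, and induces a function of \<open>(t, s)\<close> that is piecewise constant in \<open>t\<close>.
\<close>

definition P_of_rows :: "real list \<Rightarrow> (nat \<Rightarrow> real \<Rightarrow> real) \<Rightarrow> real \<Rightarrow> real \<Rightarrow> real" where
  "P_of_rows ts p t s = p (cell_index ts t) s"

definition Theta1_of_rows ::
  "(real \<Rightarrow> real) \<Rightarrow> real list \<Rightarrow> (nat \<Rightarrow> real \<Rightarrow> real) \<Rightarrow> real \<Rightarrow> real" where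
  "Theta1_of_rows \<alpha> ts p s = P_of_rows ts p s s / alpha_part \<alpha> ts s s"

definition Theta2_of_rows ::
  "real \<Rightarrow> (real \<Rightarrow> real) \<Rightarrow> real list \<Rightarrow> (nat \<Rightarrow> real \<Rightarrow> real) \<Rightarrow> real \<Rightarrow> real" where
  "Theta2_of_rows R \<alpha> ts p s = - P_of_rows ts p s s / (R * alpha_part \<alpha> ts s s)"

text \<open>
  The coefficients of the linear equation for row \<open>k\<close> are determined by the rows \<open>j > k\<close>
  and jump at the partition points. The equation is therefore imposed on each later cell
  \<open>j\<close>, with the derivative taken within that cell, while the row itself is continuous on
  the whole of \<open>[t\<^sub>k, T]\<close>. For the last row there are no later cells.
\<close>

definition is_rows ::
  "real \<Rightarrow> real \<Rightarrow> real \<Rightarrow> (real \<Rightarrow> real) \<Rightarrow> real list \<Rightarrow> (nat \<Rightarrow> real \<Rightarrow> real) \<Rightarrow> bool" where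
  "is_rows T \<sigma> R \<alpha> ts p \<longleftrightarrow>
     (\<forall>k. Suc k < length ts \<longrightarrow>
        continuous_on {ts ! k..T} (p k) \<and>
        p k T = \<alpha> (T - ts ! k) \<and>
        (\<forall>j. k < j \<and> Suc j < length ts \<longrightarrow> (\<forall>s\<in>cell ts j. \<exists>p\<^sub>s.
           (p k has_real_derivative p\<^sub>s) (at s within cell ts j) \<and>
           p\<^sub>s + 2 * p k s * (Theta1_of_rows \<alpha> ts p s + Theta2_of_rows R \<alpha> ts p s) + \<sigma>\<^sup>2 * p k s
             + \<alpha> (s - ts ! k)
               * (- (Theta1_of_rows \<alpha> ts p s)\<^sup>2 + R * (Theta2_of_rows R \<alpha> ts p s)\<^sup>2) = 0)) \<and>
        (\<forall>s\<in>{ts ! k..ts ! Suc k}. \<exists>p\<^sub>s.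
           (p k has_real_derivative p\<^sub>s) (at s within {ts ! k..ts ! Suc k}) \<and>
           p\<^sub>s + \<sigma>\<^sup>2 * p k s - (1 - R) / (R * \<alpha> (s - ts ! k)) * (p k s)\<^sup>2 = 0))"

text \<open>
  The conditions determine \<open>p k s\<close> for \<open>s \<in> [t\<^sub>k, T]\<close>; the choice operator only fixes the
  irrelevant values outside this range.
\<close>

definition rows ::
  "real \<Rightarrow> real \<Rightarrow> real \<Rightarrow> (real \<Rightarrow> real) \<Rightarrow> real list \<Rightarrow> nat \<Rightarrow> real \<Rightarrow> real" where
  "rows T \<sigma> R \<alpha> ts = (SOME p. is_rows T \<sigma> R \<alpha> ts p)"

definition P_part ::
  "real \<Rightarrow> real \<Rightarrow> real \<Rightarrow> (real \<Rightarrow> real) \<Rightarrow> real list \<Rightarrow> real \<Rightarrow> real \<Rightarrow> real" where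
  "P_part T \<sigma> R \<alpha> ts = P_of_rows ts (rows T \<sigma> R \<alpha> ts)"

definition Theta1_part ::
  "real \<Rightarrow> real \<Rightarrow> real \<Rightarrow> (real \<Rightarrow> real) \<Rightarrow> real list \<Rightarrow> real \<Rightarrow> real" where
  "Theta1_part T \<sigma> R \<alpha> ts = Theta1_of_rows \<alpha> ts (rows T \<sigma> R \<alpha> ts)"

definition Theta2_part ::
  "real \<Rightarrow> real \<Rightarrow> real \<Rightarrow> (real \<Rightarrow> real) \<Rightarrow> real list \<Rightarrow> real \<Rightarrow> real" where
  "Theta2_part T \<sigma> R \<alpha> ts = Theta2_of_rows R \<alpha> ts (rows T \<sigma> R \<alpha> ts)"

end

theory Submission
  imports Defs
begin

text \<open>
  With \<open>\<kappa> = (1 - R) / R\<close> both problems read \<open>y' = (2 \<kappa> \<theta> - \<sigma>\<^sup>2) y - \<kappa> a \<theta>\<^sup>2\<close>, where \<open>\<theta> = \<Theta>\<^sub>1\<close>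
  and \<open>a\<close> is the value of \<open>\<alpha>\<close>. Going backwards, the source term keeps a linear row positive, so
  \<open>1 / p\<close> turns the Riccati equation on the diagonal cell into a linear one: the rows exist for
  every partition.

  The error \<open>e\<^sub>k(s) = p\<^sub>k(s) - P(t\<^sub>k, s)\<close> vanishes at \<open>T\<close>. By uniform continuity of
  \<open>P(t, s) / \<alpha>(s - t)\<close>, the difference \<open>\<theta>\<^sup>\<Pi>(s) - \<theta>(s)\<close> is at most a constant times the error of the row
  of the cell containing \<open>s\<close>, plus a quantity that is small with the mesh. Hence, as long as all errors
  stay below \<open>\<eta> exp (C (T - s)) \<le> 1\<close>, their derivatives are bounded by \<open>C\<close> times this barrier;
  at the last time a barrier is touched this is a contradiction. The argument applies to any
  continuous \<open>\<alpha> > 0\<close> with \<open>\<alpha>(0) = 1\<close>.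
\<close>

subsection \<open>Partitions\<close>

text \<open>The index is the last one whose point does not exceed \<open>s\<close>; as
  \<open>s < last ts\<close>, it is not the final index. Starting the search at \<open>m\<close>
  yields a cell inside the domain of row \<open>m\<close>.\<close>

lemma sorted_cell_exists:
  fixes ts :: "real list"
  assumes "ts \<noteq> []" "m < length ts" "ts ! m \<le> s" "s < last ts"
  obtains j where "m \<le> j" "Suc j < length ts" "ts ! j \<le> s" "s < ts ! Suc j"
proof -
  define J where "J = {j. j < length ts \<and> m \<le> j \<and> ts ! j \<le> s}"
  have fin: "finite J" and ne: "J \<noteq> {}" using assms(2,3) by (auto simp: J_def)
  define j where "j = Max J"
  have j: "j < length ts" "m \<le> j" "ts ! j \<le> s"
    using Max_in[OF fin ne] unfolding j_def[symmetric] by (simp_all add: J_def)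
  have "j \<noteq> length ts - 1" using j(3) assms(1,4) by (auto simp: last_conv_nth)
  then have Sj: "Suc j < length ts" using j(1) by linarith
  have "s < ts ! Suc j"
  proof (rule ccontr)
    assume "\<not> s < ts ! Suc j"
    then have "Suc j \<in> J" using Sj j(2) by (simp add: J_def)
    then have "Suc j \<le> j" unfolding j_def using fin by simp
    then show False by simp
  qed
  then show ?thesis using that j(2,3) Sj by blast
qed

lemma sorted_nth_le:
  fixes ts :: "real list"
  assumes "sorted_wrt (<) ts" "i \<le> j" "j < length ts"
  shows "ts ! i \<le> ts ! j"
  using assms sorted_wrt_nth_less[OF assms(1), of i j] by (cases "i = j") auto

lemma sorted_nth_le_last:
  fixes ts :: "real list"
  assumes "sorted_wrt (<) ts" "j < length ts"
  shows "ts ! j \<le> last ts"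
proof -
  have "ts \<noteq> []" using assms(2) by auto
  then show ?thesis
    using sorted_nth_le[OF assms(1), of j "length ts - 1"] assms(2) by (simp add: last_conv_nth)
qed

lemma at_within_cell:
  fixes a b s :: real
  assumes "a < s" "s < b"
  shows "at s within {a..b} = at s" "at s within {a..<b} = at s"
  by (rule at_within_interior, use assms in simp)+

text \<open>Rows and antiderivatives may have kinks at the partition points, so the derivative is
  known only off a finite set. The fundamental theorem of calculus still writes the increment as the
  integral of a nonnegative function.\<close>

lemma nondecreasing_if_deriv_nonneg_except_finite:
  fixes F :: "real \<Rightarrow> real"
  assumes "finite S" "a \<le> b" "continuous_on {a..b} F"
    and deriv: "\<And>x. x \<in> {a<..<b} - S \<Longrightarrow> \<exists>D\<ge>0. (F has_real_derivative D) (at x)"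
  shows "F a \<le> F b"
proof -
  \<comment> \<open>The default 0 keeps \<open>D\<close> nonnegative at the exceptional points,
    where \<open>deriv\<close> carries no information.\<close>
  define D where "D x = (if x \<in> {a<..<b} - S then deriv F x else 0)" for x
  have "(D has_integral (F b - F a)) {a..b}"
  proof (rule fundamental_theorem_of_calculus_interior_strong[OF assms(1,2)])
    fix x assume x: "x \<in> {a<..<b} - S"
    with deriv[OF x] show "(F has_vector_derivative D x) (at x)"
      by (auto simp: D_def dest: DERIV_imp_deriv simp flip: has_real_derivative_iff_has_vector_derivative)
  qed (use assms in auto)
  moreover have "0 \<le> D x" for x
    using deriv[of x] by (auto simp: D_def dest: DERIV_imp_deriv)
  ultimately have "0 \<le> F b - F a"
    by (rule has_integral_nonneg)
  then show ?thesis by simp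
qed

subsection \<open>Piecewise linear equations\<close>

text \<open>
  The coefficients \<open>f\<close>, \<open>g\<close>, \<open>h\<close> are families indexed by the cells because they jump at the
  partition points: adjacent closed cells need different values there.
\<close>

lemma DERIV_transform_on:
  fixes f g :: "real \<Rightarrow> real"
  assumes "(f has_real_derivative d) (at s within S)" "s \<in> S" "\<And>x. x \<in> S \<Longrightarrow> f x = g x"
  shows "(g has_real_derivative d) (at s within S)"
  using has_field_derivative_transform_within[OF assms(1), of 1 g] assms by auto

text \<open>Backward induction over the cells: each cell has its own antiderivative, shifted by a
  constant so as to meet the one already built to its right. Where \<open>f\<close> jumps the two
  one-sided derivatives differ, hence the derivative within each closed cell.\<close>

lemma piecewise_antiderivative:
  fixes f :: "nat \<Rightarrow> real \<Rightarrow> real"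
  assumes ts: "ts \<noteq> []" "sorted_wrt (<) ts" and m: "m < length ts"
    and cont: "\<And>j. m \<le> j \<Longrightarrow> Suc j < length ts \<Longrightarrow> continuous_on {ts ! j..ts ! Suc j} (f j)"
  shows "\<exists>F. continuous_on {ts ! m..last ts} F \<and>
    (\<forall>j s. m \<le> j \<longrightarrow> Suc j < length ts \<longrightarrow> s \<in> {ts ! j..ts ! Suc j} \<longrightarrow>
      (F has_real_derivative f j s) (at s within {ts ! j..ts ! Suc j}))"
proof -
  have "m \<le> length ts - 1" using m by simp
  then show ?thesis using cont
  proof (induction rule: inc_induct)
    case base
    \<comment> \<open>No cell is left and the interval is the single point \<open>last ts\<close>,
      so any function serves.\<close>
    have "ts ! (length ts - 1) = last ts" using ts by (simp add: last_conv_nth)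
    then show ?case by (intro exI[of _ "\<lambda>_. 0"]) auto
  next
    case (step n)
    then have n: "Suc n < length ts" by simp
    have "\<exists>F. continuous_on {ts ! Suc n..last ts} F \<and>
      (\<forall>j s. Suc n \<le> j \<longrightarrow> Suc j < length ts \<longrightarrow> s \<in> {ts ! j..ts ! Suc j} \<longrightarrow>
        (F has_real_derivative f j s) (at s within {ts ! j..ts ! Suc j}))"
      by (rule step.IH) (rule step.prems, simp_all)
    then obtain F where F: "continuous_on {ts ! Suc n..last ts} F"
      and dF: "\<And>j s. Suc n \<le> j \<Longrightarrow> Suc j < length ts \<Longrightarrow> s \<in> {ts ! j..ts ! Suc j} \<Longrightarrow>
      (F has_real_derivative f j s) (at s within {ts ! j..ts ! Suc j})" by blast
    obtain G where dG: "\<And>s. s \<in> {ts ! n..ts ! Suc n} \<Longrightarrow>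
        (G has_real_derivative f n s) (at s within {ts ! n..ts ! Suc n})"
      using antiderivative_continuous[OF step.prems[OF le_refl n]]
      by (auto simp: has_real_derivative_iff_has_vector_derivative)
    define c where "c = ts ! Suc n"
    \<comment> \<open>The shift makes both branches take the value \<open>F c\<close> at the
      junction, so \<open>H\<close> agrees with \<open>F\<close> on every later closed cell, even on
      the one that starts at \<open>c\<close>.\<close>
    define H where "H s = (if s \<le> c then G s - G c + F c else F s)" for s
    have "continuous_on {ts ! n..last ts} H"
      unfolding H_def
    proof (rule continuous_on_cases_1)
      have "continuous_on {ts ! n..ts ! Suc n} G" by (rule DERIV_continuous_on[OF dG])
      then have "continuous_on {t \<in> {ts ! n..last ts}. t \<le> c} G"
        by (rule continuous_on_subset) (auto simp: c_def)
      then show "continuous_on {t \<in> {ts ! n..last ts}. t \<le> c} (\<lambda>s. G s - G c + F c)"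
        by (intro continuous_intros)
      show "continuous_on {t \<in> {ts ! n..last ts}. c \<le> t} F"
        by (rule continuous_on_subset[OF F]) (auto simp: c_def)
    qed auto
    moreover have "(H has_real_derivative f j s) (at s within {ts ! j..ts ! Suc j})"
      if "n \<le> j" "Suc j < length ts" "s \<in> {ts ! j..ts ! Suc j}" for j s
    proof (cases "j = n")
      case True
      have "((\<lambda>s. G s - G c + F c) has_real_derivative f n s) (at s within {ts ! n..ts ! Suc n})"
        using dG[of s] that True by (auto intro!: derivative_eq_intros)
      then show ?thesis unfolding True
        by (rule DERIV_transform_on) (use that True in \<open>auto simp: H_def c_def\<close>)
    next
      case False
      then have "c \<le> ts ! j" unfolding c_def using that by (intro sorted_nth_le[OF ts(2)]) auto
      then have "F x = H x" if "x \<in> {ts ! j..ts ! Suc j}" for x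
        using that by (cases "x = c") (auto simp: H_def)
      with False that show ?thesis
        by (intro DERIV_transform_on[OF dF]) auto
    qed
    ultimately show ?case by blast
  qed
qed

text \<open>Variation of constants: with \<open>G\<close> an antiderivative of \<open>g\<close>, the
  product \<open>y exp (- G)\<close> has derivative \<open>- h exp (- G)\<close>. Since
  \<open>h\<close> is nonnegative, going backwards this product never falls below its positive final
  value, which keeps \<open>y\<close> positive.\<close>

lemma piecewise_linear_solution:
  fixes g h :: "nat \<Rightarrow> real \<Rightarrow> real"
  assumes ts: "ts \<noteq> []" "sorted_wrt (<) ts" and m: "m < length ts"
    and contg: "\<And>j. m \<le> j \<Longrightarrow> Suc j < length ts \<Longrightarrow> continuous_on {ts ! j..ts ! Suc j} (g j)"
    and conth: "\<And>j. m \<le> j \<Longrightarrow> Suc j < length ts \<Longrightarrow> continuous_on {ts ! j..ts ! Suc j} (h j)"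
    and hpos: "\<And>j s. m \<le> j \<Longrightarrow> Suc j < length ts \<Longrightarrow> s \<in> {ts ! j..ts ! Suc j} \<Longrightarrow> 0 \<le> h j s"
    and c: "0 < c"
  shows "\<exists>y. continuous_on {ts ! m..last ts} y \<and> y (last ts) = c \<and>
    (\<forall>s\<in>{ts ! m..last ts}. 0 < y s) \<and>
    (\<forall>j s. m \<le> j \<longrightarrow> Suc j < length ts \<longrightarrow> s \<in> {ts ! j..ts ! Suc j} \<longrightarrow>
      (y has_real_derivative g j s * y s - h j s) (at s within {ts ! j..ts ! Suc j}))"
proof -
  obtain G where G: "continuous_on {ts ! m..last ts} G"
    and dG: "\<And>j s. m \<le> j \<Longrightarrow> Suc j < length ts \<Longrightarrow> s \<in> {ts ! j..ts ! Suc j} \<Longrightarrow>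
      (G has_real_derivative g j s) (at s within {ts ! j..ts ! Suc j})"
    using piecewise_antiderivative[OF ts m contg] by auto
  have sub: "{ts ! j..ts ! Suc j} \<subseteq> {ts ! m..last ts}" if "m \<le> j" "Suc j < length ts" for j
    using sorted_nth_le[OF ts(2) that(1)] sorted_nth_le_last[OF ts(2) that(2)] that by auto
  have "continuous_on {ts ! j..ts ! Suc j} (\<lambda>s. h j s * exp (- G s))"
    if "m \<le> j" "Suc j < length ts" for j
    by (intro continuous_intros conth[OF that] continuous_on_subset[OF G sub[OF that]])
  from piecewise_antiderivative[OF ts m this]
  obtain H where H: "continuous_on {ts ! m..last ts} H"
    and dH: "\<And>j s. m \<le> j \<Longrightarrow> Suc j < length ts \<Longrightarrow> s \<in> {ts ! j..ts ! Suc j} \<Longrightarrow>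
      (H has_real_derivative h j s * exp (- G s)) (at s within {ts ! j..ts ! Suc j})"
    by auto
  let ?T = "last ts"
  define y where "y s = exp (G s) * (exp (- G ?T) * c + H ?T - H s)" for s
  have "continuous_on {ts ! m..?T} y"
    unfolding y_def by (intro continuous_intros G H)
  moreover have "y ?T = c" by (simp add: y_def exp_minus)
  moreover have "0 < y s" if s: "s \<in> {ts ! m..?T}" for s
  proof -
    have "H s \<le> H ?T"
    proof (rule nondecreasing_if_deriv_nonneg_except_finite[where F = H and S = "set ts"])
      fix x assume x: "x \<in> {s<..<?T} - set ts"
      obtain j where j: "m \<le> j" "Suc j < length ts" "ts ! j \<le> x" "x < ts ! Suc j"
        by (rule sorted_cell_exists[OF ts(1) m, of x]) (use x s in auto)
      moreover have "x \<noteq> ts ! j" using x j by auto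
      ultimately have "ts ! j < x" by simp
      with dH[of j x] j have "(H has_real_derivative h j x * exp (- G x)) (at x)"
        by (simp add: at_within_cell)
      moreover have "0 \<le> h j x * exp (- G x)" using hpos[of j x] j by simp
      ultimately show "\<exists>D\<ge>0. (H has_real_derivative D) (at x)" by blast
    next
      show "continuous_on {s..?T} H" using s by (intro continuous_on_subset[OF H]) auto
    qed (use s in auto)
    moreover have "0 < exp (- G ?T) * c" using c by simp
    ultimately show ?thesis by (simp add: y_def)
  qed
  moreover have "(y has_real_derivative g j s * y s - h j s) (at s within {ts ! j..ts ! Suc j})"
    if "m \<le> j" "Suc j < length ts" "s \<in> {ts ! j..ts ! Suc j}" for j s
    unfolding y_def using dG[OF that] dH[OF that]
    by (auto intro!: derivative_eq_intros simp: algebra_simps simp flip: exp_add)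
  ultimately show ?thesis by blast
qed

text \<open>For \<open>u = 1 / q\<close> the equation becomes
  \<open>u' = \<sigma>\<^sup>2 u - \<kappa> / \<beta>\<close>, which is linear with a source of the
  right sign. Its solution stays positive, so \<open>q\<close> exists on the whole interval without
  blow-up.\<close>

lemma riccati_solution:
  fixes \<beta> :: "real \<Rightarrow> real"
  assumes ab: "a < b" and \<beta>: "continuous_on {a..b} \<beta>" "\<And>s. s \<in> {a..b} \<Longrightarrow> 0 < \<beta> s"
    and "0 \<le> \<kappa>" "0 < c"
  shows "\<exists>q. q b = c \<and> (\<forall>s\<in>{a..b}. 0 < q s \<and>
    (q has_real_derivative \<kappa> * (q s)\<^sup>2 / \<beta> s - \<sigma>\<^sup>2 * q s) (at s within {a..b}))"
proof -
  have cont: "continuous_on {a..b} (\<lambda>s. \<kappa> / \<beta> s)"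
    by (intro continuous_intros \<beta>) (use \<beta>(2) in force)
  have pos: "0 \<le> \<kappa> / \<beta> s" if "s \<in> {a..b}" for s
    using \<open>0 \<le> \<kappa>\<close> \<beta>(2)[OF that] by simp
  \<comment> \<open>A partition with a single cell makes the piecewise linear result applicable to
    \<open>{a..b}\<close>.\<close>
  define ts where "ts = [a, b]"
  have ts: "ts \<noteq> []" "sorted_wrt (<) ts" "0 < length ts" "last ts = b" "ts ! 0 = a" "ts ! Suc 0 = b"
    and j: "Suc j < length ts \<longleftrightarrow> j = 0" for j
    using ab by (auto simp: ts_def)
  have "\<exists>u. continuous_on {ts ! 0..last ts} u \<and> u (last ts) = 1 / c \<and>
    (\<forall>s\<in>{ts ! 0..last ts}. 0 < u s) \<and>
    (\<forall>j s. 0 \<le> j \<longrightarrow> Suc j < length ts \<longrightarrow> s \<in> {ts ! j..ts ! Suc j} \<longrightarrow>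
      (u has_real_derivative \<sigma>\<^sup>2 * u s - \<kappa> / \<beta> s) (at s within {ts ! j..ts ! Suc j}))"
    by (rule piecewise_linear_solution[OF ts(1-3), of "\<lambda>_ _. \<sigma>\<^sup>2" "\<lambda>_ s. \<kappa> / \<beta> s"])
      (use cont pos \<open>0 < c\<close> in \<open>simp_all add: j ts\<close>)
  then obtain u where "u (last ts) = 1 / c" "\<forall>s\<in>{ts ! 0..last ts}. 0 < u s"
    "\<forall>j s. 0 \<le> j \<longrightarrow> Suc j < length ts \<longrightarrow> s \<in> {ts ! j..ts ! Suc j} \<longrightarrow>
      (u has_real_derivative \<sigma>\<^sup>2 * u s - \<kappa> / \<beta> s) (at s within {ts ! j..ts ! Suc j})"
    by (elim exE conjE)
  then have u: "u b = 1 / c" "\<And>s. s \<in> {a..b} \<Longrightarrow> 0 < u s"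
    "\<And>s. s \<in> {a..b} \<Longrightarrow> (u has_real_derivative \<sigma>\<^sup>2 * u s - \<kappa> / \<beta> s) (at s within {a..b})"
    using ts(4-6) j[of 0] by (simp, simp, metis le_refl)
  have "((\<lambda>s. 1 / u s) has_real_derivative \<kappa> * (1 / u s)\<^sup>2 / \<beta> s - \<sigma>\<^sup>2 * (1 / u s)) (at s within {a..b})"
    if s: "s \<in> {a..b}" for s
  proof -
    have nz: "u s \<noteq> 0" "\<beta> s \<noteq> 0" using u(2)[OF s] \<beta>(2)[OF s] by auto
    have "((\<lambda>s. inverse (u s)) has_real_derivative
        - (inverse (u s) * (\<sigma>\<^sup>2 * u s - \<kappa> / \<beta> s) * inverse (u s))) (at s within {a..b})"
      by (rule DERIV_inverse'[OF u(3)[OF s] nz(1)])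
    moreover have "- (inverse (u s) * (\<sigma>\<^sup>2 * u s - \<kappa> / \<beta> s) * inverse (u s))
        = \<kappa> * (1 / u s)\<^sup>2 / \<beta> s - \<sigma>\<^sup>2 * (1 / u s)"
      using nz by (simp add: field_simps power2_eq_square)
    ultimately show ?thesis by (simp add: inverse_eq_divide)
  qed
  with u show ?thesis by (intro exI[of _ "\<lambda>s. 1 / u s"]) auto
qed

subsection \<open>Existence of the rows\<close>

text \<open>
  Written in terms of \<open>\<Theta>\<^sub>1\<close> alone, with \<open>\<kappa> = (1 - R) / R\<close>, the linear and the Riccati equation
  become one and the same equation.
\<close>

definition row_rhs :: "real \<Rightarrow> real \<Rightarrow> real \<Rightarrow> real \<Rightarrow> real \<Rightarrow> real" where
  "row_rhs \<kappa> \<sigma> a \<theta> y = (2 * \<kappa> * \<theta> - \<sigma>\<^sup>2) * y - \<kappa> * a * \<theta>\<^sup>2"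

text \<open>On its own cell a row determines its own coefficient \<open>y / a\<close>: the linear
  term gives \<open>2 \<kappa> y\<^sup>2 / a\<close>, the source removes
  \<open>\<kappa> y\<^sup>2 / a\<close>, and the Riccati nonlinearity is left.\<close>

lemma row_rhs_riccati:
  assumes "a \<noteq> 0"
  shows "row_rhs \<kappa> \<sigma> a (y / a) y = \<kappa> * y\<^sup>2 / a - \<sigma>\<^sup>2 * y"
  using assms by (simp add: row_rhs_def field_simps power2_eq_square)

text \<open>The rows are built from the last one backwards. For row \<open>n\<close> the later rows
  supply the coefficients of a linear equation down to \<open>ts ! Suc n\<close>; the positive value
  reached there is the final datum of the Riccati equation on cell \<open>n\<close>.\<close>

lemma rows_recursion:
  fixes \<alpha> :: "real \<Rightarrow> real"
  assumes ts: "ts \<noteq> []" "sorted_wrt (<) ts" and m: "m < length ts"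
    and \<alpha>: "continuous_on {0..} \<alpha>" "\<And>r. 0 \<le> r \<Longrightarrow> 0 < \<alpha> r" and \<kappa>: "0 \<le> \<kappa>"
  shows "\<exists>p. \<forall>k. m \<le> k \<longrightarrow> Suc k < length ts \<longrightarrow>
    continuous_on {ts ! k..last ts} (p k) \<and> p k (last ts) = \<alpha> (last ts - ts ! k) \<and>
    (\<forall>s\<in>{ts ! k..last ts}. 0 < p k s) \<and>
    (\<forall>j s. k \<le> j \<longrightarrow> Suc j < length ts \<longrightarrow> s \<in> {ts ! j..ts ! Suc j} \<longrightarrow>
      (p k has_real_derivative row_rhs \<kappa> \<sigma> (\<alpha> (s - ts ! k)) (p j s / \<alpha> (s - ts ! j)) (p k s))
        (at s within {ts ! j..ts ! Suc j}))"
proof -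
  let ?T = "last ts"
  define row where "row p k \<longleftrightarrow> continuous_on {ts ! k..?T} (p k) \<and> p k ?T = \<alpha> (?T - ts ! k) \<and>
    (\<forall>s\<in>{ts ! k..?T}. 0 < p k s) \<and>
    (\<forall>j s. k \<le> j \<longrightarrow> Suc j < length ts \<longrightarrow> s \<in> {ts ! j..ts ! Suc j} \<longrightarrow>
      (p k has_real_derivative row_rhs \<kappa> \<sigma> (\<alpha> (s - ts ! k)) (p j s / \<alpha> (s - ts ! j)) (p k s))
        (at s within {ts ! j..ts ! Suc j}))" for p k
  have cell_le: "{ts ! j..ts ! Suc j} \<subseteq> {ts ! k..?T}" if "k \<le> j" "Suc j < length ts" for j k
    using sorted_nth_le[OF ts(2) that(1)] sorted_nth_le_last[OF ts(2) that(2)] that by auto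
  have cont\<alpha>: "continuous_on A (\<lambda>s. \<alpha> (s - a))" if "A \<subseteq> {a..}" for A a
    by (rule continuous_on_compose2[OF \<alpha>(1)]) (use that in \<open>auto intro!: continuous_intros\<close>)
  have "m \<le> length ts - 1" using m by simp
  then have "\<exists>p. \<forall>k. m \<le> k \<longrightarrow> Suc k < length ts \<longrightarrow> row p k"
  proof (induction rule: inc_induct)
    case base
    then show ?case by auto
  next
    case (step n)
    then have n: "Suc n < length ts" by simp
    from step obtain p where p: "row p k" if "Suc n \<le> k" "Suc k < length ts" for k by blast
    let ?a = "ts ! n" and ?b = "ts ! Suc n"
    have ab: "?a < ?b" "?b \<le> ?T"
      using sorted_wrt_nth_less[OF ts(2), of n "Suc n"] sorted_nth_le_last[OF ts(2) n] n by auto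
    \<comment> \<open>On the closed cell \<open>j\<close> this is the continuous version of the
      coefficient: at \<open>ts ! Suc j\<close> it still uses row \<open>j\<close>, whereas
      \<open>Theta1_of_rows\<close> uses the next row there unless the cell is the last one.\<close>
    define \<theta> where "\<theta> j s = p j s / \<alpha> (s - ts ! j)" for j s
    have cont\<theta>: "continuous_on {ts ! j..ts ! Suc j} (\<theta> j)" if j: "Suc n \<le> j" "Suc j < length ts" for j
    proof -
      have "continuous_on {ts ! j..?T} (p j)" using p[OF j] by (simp add: row_def)
      then have "continuous_on {ts ! j..ts ! Suc j} (p j)"
        by (rule continuous_on_subset) (use cell_le[OF le_refl j(2)] in auto)
      moreover have "\<forall>s\<in>{ts ! j..ts ! Suc j}. \<alpha> (s - ts ! j) \<noteq> 0"
        using \<alpha>(2) by (metis atLeastAtMost_iff diff_ge_0_iff_ge less_irrefl)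
      ultimately show ?thesis
        unfolding \<theta>_def by (intro continuous_on_divide cont\<alpha>) auto
    qed
    have "\<exists>y. continuous_on {?b..?T} y \<and> y ?T = \<alpha> (?T - ?a) \<and> (\<forall>s\<in>{?b..?T}. 0 < y s) \<and>
      (\<forall>j s. Suc n \<le> j \<longrightarrow> Suc j < length ts \<longrightarrow> s \<in> {ts ! j..ts ! Suc j} \<longrightarrow>
        (y has_real_derivative (2 * \<kappa> * \<theta> j s - \<sigma>\<^sup>2) * y s - \<kappa> * \<alpha> (s - ?a) * (\<theta> j s)\<^sup>2)
          (at s within {ts ! j..ts ! Suc j}))"
    proof (rule piecewise_linear_solution[OF ts n])
      fix j assume j: "Suc n \<le> j" "Suc j < length ts"
      have sub: "{ts ! j..ts ! Suc j} \<subseteq> {?a..}" using cell_le[of n j] j by auto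
      show "continuous_on {ts ! j..ts ! Suc j} (\<lambda>s. 2 * \<kappa> * \<theta> j s - \<sigma>\<^sup>2)"
        by (intro continuous_intros cont\<theta> j)
      show "continuous_on {ts ! j..ts ! Suc j} (\<lambda>s. \<kappa> * \<alpha> (s - ?a) * (\<theta> j s)\<^sup>2)"
        by (intro continuous_intros cont\<theta> j cont\<alpha> sub)
      show "0 \<le> \<kappa> * \<alpha> (s - ?a) * (\<theta> j s)\<^sup>2" if "s \<in> {ts ! j..ts ! Suc j}" for s
        using \<kappa> \<alpha>(2)[of "s - ?a"] sub that by auto
    next
      show "0 < \<alpha> (?T - ?a)" using \<alpha>(2) ab by simp
    qed
    then obtain y where y: "continuous_on {?b..?T} y" "y ?T = \<alpha> (?T - ?a)"
      "\<And>s. s \<in> {?b..?T} \<Longrightarrow> 0 < y s"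
      and dy: "\<And>j s. Suc n \<le> j \<Longrightarrow> Suc j < length ts \<Longrightarrow> s \<in> {ts ! j..ts ! Suc j} \<Longrightarrow>
        (y has_real_derivative (2 * \<kappa> * \<theta> j s - \<sigma>\<^sup>2) * y s - \<kappa> * \<alpha> (s - ?a) * (\<theta> j s)\<^sup>2)
          (at s within {ts ! j..ts ! Suc j})"
      by blast
    have "\<exists>q. q ?b = y ?b \<and> (\<forall>s\<in>{?a..?b}. 0 < q s \<and>
      (q has_real_derivative \<kappa> * (q s)\<^sup>2 / \<alpha> (s - ?a) - \<sigma>\<^sup>2 * q s) (at s within {?a..?b}))"
      by (rule riccati_solution[OF ab(1) cont\<alpha> _ \<kappa>]) (use \<alpha>(2) y(3) ab in auto)
    then obtain q where q: "q ?b = y ?b" "\<And>s. s \<in> {?a..?b} \<Longrightarrow> 0 < q s"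
      and dq: "\<And>s. s \<in> {?a..?b} \<Longrightarrow>
        (q has_real_derivative \<kappa> * (q s)\<^sup>2 / \<alpha> (s - ?a) - \<sigma>\<^sup>2 * q s) (at s within {?a..?b})"
      by blast
    define r where "r s = (if s \<le> ?b then q s else y s)" for s
    have rq: "r s = q s" if "s \<le> ?b" for s using that by (simp add: r_def)
    have ry: "r s = y s" if "?b \<le> s" for s using that q(1) by (auto simp: r_def)
    \<comment> \<open>The predicate \<open>row\<close> at index \<open>k\<close> involves only rows
      with index at least \<open>k\<close>, so overwriting row \<open>n\<close> leaves all later
      rows valid.\<close>
    define p' where "p' = p(n := r)"
    have p'_eq: "p' k = p k" if "Suc n \<le> k" for k using that by (simp add: p'_def)
    have p'_n: "p' n = r" by (simp add: p'_def)
    have "row p' n"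
      unfolding row_def p'_n
    proof (intro conjI ballI allI impI)
      show "continuous_on {?a..?T} r"
        unfolding r_def
      proof (rule continuous_on_cases_1)
        show "continuous_on {t \<in> {?a..?T}. t \<le> ?b} q"
          by (rule continuous_on_subset[OF DERIV_continuous_on[OF dq]]) auto
        show "continuous_on {t \<in> {?a..?T}. ?b \<le> t} y"
          by (rule continuous_on_subset[OF y(1)]) auto
      qed (use q in auto)
      show "r ?T = \<alpha> (?T - ?a)" using y(2) ry ab by simp
      show "0 < r s" if "s \<in> {?a..?T}" for s
        using q(2)[of s] y(3)[of s] that by (auto simp: r_def)
      fix j s assume j: "n \<le> j" "Suc j < length ts" and s: "s \<in> {ts ! j..ts ! Suc j}"
      show "(r has_real_derivative row_rhs \<kappa> \<sigma> (\<alpha> (s - ?a)) (p' j s / \<alpha> (s - ts ! j)) (r s))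
          (at s within {ts ! j..ts ! Suc j})"
      proof (cases "j = n")
        case True
        have nz: "\<alpha> (s - ?a) \<noteq> 0" using \<alpha>(2)[of "s - ?a"] s True by auto
        have "(r has_real_derivative \<kappa> * (q s)\<^sup>2 / \<alpha> (s - ?a) - \<sigma>\<^sup>2 * q s) (at s within {?a..?b})"
          by (rule DERIV_transform_on[OF dq]) (use s True rq in auto)
        moreover have "q s = r s" using rq s True by simp
        ultimately show ?thesis
          using row_rhs_riccati[OF nz] by (simp add: True p'_n)
      next
        case False
        then have j': "Suc n \<le> j" using j by simp
        have b: "?b \<le> x" if "x \<in> {ts ! j..ts ! Suc j}" for x
          using cell_le[OF j' j(2)] that by auto
        have "(r has_real_derivative (2 * \<kappa> * \<theta> j s - \<sigma>\<^sup>2) * y s - \<kappa> * \<alpha> (s - ?a) * (\<theta> j s)\<^sup>2)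
          (at s within {ts ! j..ts ! Suc j})"
          by (rule DERIV_transform_on[OF dy[OF j' j(2) s] s]) (use b ry in auto)
        then show ?thesis
          using b[OF s] by (simp add: ry p'_eq[OF j'] \<theta>_def row_rhs_def)
      qed
    qed
    moreover have "row p' k" if "Suc n \<le> k" "Suc k < length ts" for k
    proof -
      have eq: "p' j = p j" if "k \<le> j" for j using p'_eq \<open>Suc n \<le> k\<close> that by simp
      show ?thesis using p[OF that] eq unfolding row_def by simp
    qed
    ultimately have "row p' k" if "n \<le> k" "Suc k < length ts" for k
      using that by (cases "k = n") auto
    then show ?case by blast
  qed
  then show ?thesis unfolding row_def .
qed

subsection \<open>Cells and the row equations\<close>

lemma cell_subset: "cell ts j \<subseteq> {ts ! j..ts ! Suc j}"
  by (auto simp: cell_def)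

lemma is_partitionD:
  assumes "is_partition T ts"
  shows "ts \<noteq> []" "sorted_wrt (<) ts" "last ts = T" "ts ! 0 = 0"
  using assms by (auto simp: is_partition_def hd_conv_nth)

lemma cell_index_eq:
  assumes ts: "is_partition T ts" and j: "Suc j < length ts" and t: "t \<in> cell ts j"
  shows "cell_index ts t = j"
  unfolding cell_index_def
proof (rule the_equality)
  fix k assume k: "Suc k < length ts \<and> t \<in> cell ts k"
  \<comment> \<open>The earlier of two distinct cells is not the last one, hence it is open on the
    right and ends before the later one begins.\<close>
  have *: False if "i < l" "Suc l < length ts" "t \<in> cell ts i" "t \<in> cell ts l" for i l
  proof -
    have "t < ts ! Suc i" using that(1-3) by (auto simp: cell_def)
    moreover have "ts ! Suc i \<le> ts ! l"
      using sorted_nth_le[OF is_partitionD(2)[OF ts], of "Suc i" l] that by simp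
    moreover have "ts ! l \<le> t" using that(4) cell_subset by fastforce
    ultimately show False by simp
  qed
  show "k = j" using *[of k j] *[of j k] k j t by (meson linorder_neqE_nat)
qed (use j t in simp)

text \<open>The point \<open>T\<close> is treated separately: it lies only in the last cell, the one
  that is closed on the right.\<close>

lemma cell_exists:
  assumes ts: "is_partition T ts" and T: "0 < T" and t: "t \<in> {0..T}"
  obtains k where "Suc k < length ts" "t \<in> cell ts k"
proof (cases "t < T")
  case True
  obtain k where "Suc k < length ts" "ts ! k \<le> t" "t < ts ! Suc k"
    by (rule sorted_cell_exists[of ts 0 t]) (use is_partitionD[OF ts] True t in auto)
  then show ?thesis using that[of k] by (auto simp: cell_def)
next
  case False
  then have tT: "t = T" using t by simp
  have ne: "ts ! (length ts - 1) = T" using is_partitionD[OF ts] by (simp add: last_conv_nth)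
  \<comment> \<open>A one-point partition would force \<open>T = 0\<close>. Hence the subtraction in
    \<open>length ts - 2\<close> is not truncated.\<close>
  then have len: "2 \<le> length ts"
    using is_partitionD[OF ts] T by (cases "length ts - 1") auto
  define k where "k = length ts - 2"
  have k: "Suc (Suc k) = length ts" using len by (simp add: k_def)
  then have "Suc k = length ts - 1" by simp
  then have "ts ! Suc k = T" using ne by simp
  moreover have "ts ! k \<le> ts ! Suc k"
    using sorted_nth_le[OF is_partitionD(2)[OF ts], of k "Suc k"] k by simp
  ultimately have "t \<in> cell ts k" using k tT by (simp add: cell_def)
  then show ?thesis using that[of k] k by simp
qed

lemma Theta1_of_rows_cell:
  assumes "is_partition T ts" "Suc j < length ts" "s \<in> cell ts j"
  shows "Theta1_of_rows \<alpha> ts p s = p j s / \<alpha> (s - ts ! j)"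
  using cell_index_eq[OF assms] by (simp add: Theta1_of_rows_def P_of_rows_def alpha_part_def)

lemma Theta2_of_rows_eq: "Theta2_of_rows R \<alpha> ts p s = - Theta1_of_rows \<alpha> ts p s / R"
  by (simp add: Theta2_of_rows_def Theta1_of_rows_def)

text \<open>With \<open>\<kappa> = (1 - R) / R\<close> one has
  \<open>\<theta> - \<theta> / R = - \<kappa> \<theta>\<close> and \<open>- \<theta>\<^sup>2 + R
  (\<theta> / R)\<^sup>2 = \<kappa> \<theta>\<^sup>2\<close>.\<close>

lemma row_rhs_Theta_iff:
  assumes "R \<noteq> 0"
  shows "d + 2 * y * (\<theta> + - \<theta> / R) + \<sigma>\<^sup>2 * y + a * (- \<theta>\<^sup>2 + R * (- \<theta> / R)\<^sup>2) = 0
    \<longleftrightarrow> d = row_rhs ((1 - R) / R) \<sigma> a \<theta> y"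
proof -
  have "2 * y * (\<theta> + - \<theta> / R) + \<sigma>\<^sup>2 * y + a * (- \<theta>\<^sup>2 + R * (- \<theta> / R)\<^sup>2)
      = - row_rhs ((1 - R) / R) \<sigma> a \<theta> y"
    using assms by (simp add: row_rhs_def field_simps power2_eq_square)
  then show ?thesis by linarith
qed

lemma row_riccati_iff:
  assumes "R \<noteq> 0" "a \<noteq> 0"
  shows "d + \<sigma>\<^sup>2 * y - (1 - R) / (R * a) * y\<^sup>2 = 0
    \<longleftrightarrow> d = row_rhs ((1 - R) / R) \<sigma> a (y / a) y"
  unfolding row_rhs_riccati[OF assms(2)] by (simp add: field_simps)

text \<open>The recursion gives the equations on closed cells. They restrict to the sets
  \<open>cell ts j\<close>, on which \<open>Theta1_of_rows\<close> is exactly the quotient formed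
  from row \<open>j\<close>.\<close>

lemma is_rows_exists:
  assumes ts: "is_partition T ts" and R: "0 < R" "R \<le> 1"
    and \<alpha>: "continuous_on {0..} \<alpha>" "\<And>r. 0 \<le> r \<Longrightarrow> 0 < \<alpha> r"
  shows "\<exists>p. is_rows T \<sigma> R \<alpha> ts p"
proof -
  define \<kappa> where "\<kappa> = (1 - R) / R"
  have "0 \<le> \<kappa>" using R by (simp add: \<kappa>_def)
  note ts' = is_partitionD[OF ts]
  obtain p where p: "\<And>k. Suc k < length ts \<Longrightarrow> continuous_on {ts ! k..T} (p k)"
      "\<And>k. Suc k < length ts \<Longrightarrow> p k T = \<alpha> (T - ts ! k)"
    and dp: "\<And>k j s. Suc k < length ts \<Longrightarrow> k \<le> j \<Longrightarrow> Suc j < length ts \<Longrightarrow>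
      s \<in> {ts ! j..ts ! Suc j} \<Longrightarrow>
      (p k has_real_derivative row_rhs \<kappa> \<sigma> (\<alpha> (s - ts ! k)) (p j s / \<alpha> (s - ts ! j)) (p k s))
        (at s within {ts ! j..ts ! Suc j})"
    using rows_recursion[OF ts'(1,2) _ \<alpha> \<open>0 \<le> \<kappa>\<close>, of 0 \<sigma>] ts'(1,3)
    by (metis (no_types, lifting) le0 length_greater_0_conv)
  have "is_rows T \<sigma> R \<alpha> ts p"
    unfolding is_rows_def
  proof (intro allI impI conjI ballI)
    fix k assume k: "Suc k < length ts"
    show "continuous_on {ts ! k..T} (p k)" "p k T = \<alpha> (T - ts ! k)" using p[OF k] by auto
    { fix j s assume j: "k < j \<and> Suc j < length ts" and s: "s \<in> cell ts j"
      have "(p k has_real_derivative row_rhs \<kappa> \<sigma> (\<alpha> (s - ts ! k)) (p j s / \<alpha> (s - ts ! j)) (p k s))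
        (at s within cell ts j)"
        by (rule has_field_derivative_subset[OF dp cell_subset])
          (use k j subsetD[OF cell_subset s] in auto)
      moreover have "row_rhs \<kappa> \<sigma> (\<alpha> (s - ts ! k)) (p j s / \<alpha> (s - ts ! j)) (p k s) + 2 * p k s *
          (Theta1_of_rows \<alpha> ts p s + Theta2_of_rows R \<alpha> ts p s) + \<sigma>\<^sup>2 * p k s + \<alpha> (s - ts ! k) *
          (- (Theta1_of_rows \<alpha> ts p s)\<^sup>2 + R * (Theta2_of_rows R \<alpha> ts p s)\<^sup>2) = 0"
        unfolding Theta2_of_rows_eq using R j
        by (subst row_rhs_Theta_iff) (simp_all add: \<kappa>_def Theta1_of_rows_cell[OF ts _ s])
      ultimately show "\<exists>p\<^sub>s. (p k has_real_derivative p\<^sub>s) (at s within cell ts j) \<and>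
           p\<^sub>s + 2 * p k s * (Theta1_of_rows \<alpha> ts p s + Theta2_of_rows R \<alpha> ts p s) + \<sigma>\<^sup>2 * p k s
             + \<alpha> (s - ts ! k)
               * (- (Theta1_of_rows \<alpha> ts p s)\<^sup>2 + R * (Theta2_of_rows R \<alpha> ts p s)\<^sup>2) = 0"
        by blast }
    { fix s assume s: "s \<in> {ts ! k..ts ! Suc k}"
      have nz: "R \<noteq> 0" "\<alpha> (s - ts ! k) \<noteq> 0" using R(1) \<alpha>(2)[of "s - ts ! k"] s by auto
      show "\<exists>p\<^sub>s. (p k has_real_derivative p\<^sub>s) (at s within {ts ! k..ts ! Suc k}) \<and>
           p\<^sub>s + \<sigma>\<^sup>2 * p k s - (1 - R) / (R * \<alpha> (s - ts ! k)) * (p k s)\<^sup>2 = 0"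
        using dp[OF k le_refl k s] row_riccati_iff[THEN iffD2, OF nz refl]
        unfolding \<kappa>_def by blast }
  qed
  then show ?thesis by blast
qed

text \<open>In the interior of a cell the derivative within the cell is two-sided, and the Riccati
  case \<open>j = k\<close> and the linear case \<open>k < j\<close> share one right-hand side. Any
  family satisfying \<open>is_rows\<close> is covered, so the result applies to the one selected by
  \<open>rows\<close>.\<close>

lemma is_rows_deriv:
  assumes rows: "is_rows T \<sigma> R \<alpha> ts p" and ts: "is_partition T ts" and R: "0 < R"
    and \<alpha>: "\<And>r. 0 \<le> r \<Longrightarrow> 0 < \<alpha> r"
    and j: "k \<le> j" "Suc j < length ts" and s: "ts ! j < s" "s < ts ! Suc j"
  shows "(p k has_real_derivative
    row_rhs ((1 - R) / R) \<sigma> (\<alpha> (s - ts ! k)) (p j s / \<alpha> (s - ts ! j)) (p k s)) (at s)"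
proof (cases "j = k")
  case True
  then obtain d where d: "(p k has_real_derivative d) (at s within {ts ! k..ts ! Suc k})"
    and eq: "d + \<sigma>\<^sup>2 * p k s - (1 - R) / (R * \<alpha> (s - ts ! k)) * (p k s)\<^sup>2 = 0"
    using rows j s unfolding is_rows_def by fastforce
  have "\<alpha> (s - ts ! k) \<noteq> 0" using \<alpha>[of "s - ts ! k"] s True by auto
  then have "d = row_rhs ((1 - R) / R) \<sigma> (\<alpha> (s - ts ! k)) (p k s / \<alpha> (s - ts ! k)) (p k s)"
    using eq R row_riccati_iff by simp
  then show ?thesis using d True at_within_cell(1)[OF s] by simp
next
  case False
  then have "k < j" using j by simp
  have sc: "s \<in> cell ts j" using s by (auto simp: cell_def)
  obtain d where d: "(p k has_real_derivative d) (at s within cell ts j)"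
    and eq: "d + 2 * p k s * (Theta1_of_rows \<alpha> ts p s + Theta2_of_rows R \<alpha> ts p s) + \<sigma>\<^sup>2 * p k s
             + \<alpha> (s - ts ! k)
               * (- (Theta1_of_rows \<alpha> ts p s)\<^sup>2 + R * (Theta2_of_rows R \<alpha> ts p s)\<^sup>2) = 0"
    using rows \<open>k < j\<close> j sc unfolding is_rows_def by (meson Suc_lessD order.strict_trans Suc_mono)
  have "d = row_rhs ((1 - R) / R) \<sigma> (\<alpha> (s - ts ! k)) (p j s / \<alpha> (s - ts ! j)) (p k s)"
    using eq R unfolding Theta2_of_rows_eq
    by (subst (asm) row_rhs_Theta_iff) (simp_all add: Theta1_of_rows_cell[OF ts j(2) sc])
  moreover have "at s within cell ts j = at s"
    using at_within_cell[OF s] by (simp add: cell_def)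
  ultimately show ?thesis using d by simp
qed

subsection \<open>A barrier for the error\<close>

text \<open>
  The derivative bound is only required while every error lies below the barrier. It may hence
  use a priori bounds that follow from smallness of the errors, and no separate bounds on the
  rows are needed.
\<close>

lemma exp_barrier:
  fixes e :: "'i \<Rightarrow> real \<Rightarrow> real" and l :: "'i \<Rightarrow> real"
  assumes fin: "finite I" "finite S" and \<eta>: "0 < \<eta>"
    and cont: "\<And>i. i \<in> I \<Longrightarrow> continuous_on {l i..T} (e i)"
    and final: "\<And>i. i \<in> I \<Longrightarrow> e i T = 0"
    and deriv: "\<And>i s. i \<in> I \<Longrightarrow> s \<in> {l i<..<T} - S \<Longrightarrow>
      (\<And>j. j \<in> I \<Longrightarrow> l j \<le> s \<Longrightarrow> \<bar>e j s\<bar> < \<eta> * exp (C * (T - s))) \<Longrightarrow>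
      \<exists>d. (e i has_real_derivative d) (at s) \<and> \<bar>d\<bar> \<le> C * (\<eta> * exp (C * (T - s)))"
    and i: "i \<in> I" and s: "s \<in> {l i..T}"
  shows "\<bar>e i s\<bar> < \<eta> * exp (C * (T - s))"
proof (rule ccontr)
  assume bad: "\<not> \<bar>e i s\<bar> < \<eta> * exp (C * (T - s))"
  define b where "b s = \<eta> * exp (C * (T - s))" for s
  have db: "(b has_real_derivative - (C * b x)) (at x)" for x
    unfolding b_def by (auto intro!: derivative_eq_intros)
  have contb: "continuous_on A b" for A unfolding b_def by (intro continuous_intros)
  \<comment> \<open>\<open>Z\<close> collects the times at which some error reaches the barrier. As
    a finite union of compact sets it has a latest element \<open>z\<close>; after \<open>z\<close>
    all errors lie below the barrier and the derivative bound is available.\<close>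
  define Z where "Z = (\<Union>i\<in>I. {s \<in> {l i..T}. b s \<le> \<bar>e i s\<bar>})"
  have "compact {s \<in> {l i..T}. b s \<le> \<bar>e i s\<bar>}" if "i \<in> I" for i
  proof -
    have "closed {s \<in> {l i..T}. b s \<le> \<bar>e i s\<bar>}"
      by (intro continuous_on_closed_Collect_le contb continuous_intros cont that closed_atLeastAtMost)
    moreover have "bounded {s \<in> {l i..T}. b s \<le> \<bar>e i s\<bar>}"
      by (rule bounded_subset[OF bounded_closed_interval]) auto
    ultimately show ?thesis by (simp add: compact_eq_bounded_closed)
  qed
  then have "compact Z" unfolding Z_def by (intro compact_UN fin(1))
  moreover have "s \<in> Z" using bad i s by (auto simp: Z_def b_def)
  ultimately obtain z where z: "z \<in> Z" and zmax: "\<And>x. x \<in> Z \<Longrightarrow> x \<le> z"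
    using compact_attains_sup[of Z] by auto
  then obtain k where k: "k \<in> I" "l k \<le> z" "z \<le> T" "b z \<le> \<bar>e k z\<bar>" by (auto simp: Z_def)
  have dk: "\<exists>d. (e k has_real_derivative d) (at x) \<and> \<bar>d\<bar> \<le> C * b x"
    if x: "x \<in> {z<..<T} - S" for x
  proof -
    have "x \<notin> Z" using zmax[of x] x by auto
    then have "\<bar>e j x\<bar> < b x" if "j \<in> I" "l j \<le> x" for j
      using that x by (auto simp: Z_def)
    with deriv[OF k(1), of x] x k(2) show ?thesis by (auto simp: b_def)
  qed
  have contk: "continuous_on {z..T} (e k)"
    by (rule continuous_on_subset[OF cont[OF k(1)]]) (use k in auto)
  \<comment> \<open>Since \<open>b' = - C b\<close>, both \<open>e k - b\<close> and
    \<open>- e k - b\<close> are nondecreasing on \<open>{z..T}\<close>. Both equal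
    \<open>- \<eta>\<close> at \<open>T\<close>, hence are negative at \<open>z\<close>, contrary to
    the choice of \<open>k\<close> and \<open>z\<close>.\<close>
  have le: "c * e k z - b z \<le> c * e k T - b T" if c: "\<bar>c\<bar> = 1" for c
  proof (rule nondecreasing_if_deriv_nonneg_except_finite[where F = "\<lambda>s. c * e k s - b s", OF fin(2) k(3)])
    show "continuous_on {z..T} (\<lambda>s. c * e k s - b s)"
      by (intro continuous_intros contk contb)
    fix x assume "x \<in> {z<..<T} - S"
    from dk[OF this] obtain d where d: "(e k has_real_derivative d) (at x)" "\<bar>d\<bar> \<le> C * b x" by blast
    have "((\<lambda>s. c * e k s - b s) has_real_derivative c * d - - (C * b x)) (at x)"
      by (intro DERIV_diff DERIV_cmult d db)
    moreover have "\<bar>c * d\<bar> = \<bar>d\<bar>" using c by (simp add: abs_mult)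
    then have "0 \<le> c * d - - (C * b x)" using d(2) by linarith
    ultimately show "\<exists>D\<ge>0. ((\<lambda>s. c * e k s - b s) has_real_derivative D) (at x)" by blast
  qed
  have "b T = \<eta>" by (simp add: b_def)
  then show False using le[of 1] le[of "- 1"] final[OF k(1)] k(4) \<eta> by simp
qed

text \<open>This Lipschitz estimate converts the errors of the rows and of the coefficient into a
  bound on the derivative of a row error.\<close>

lemma row_rhs_diff_le:
  assumes "0 \<le> \<kappa>" "\<bar>\<theta>\<bar> \<le> K" "\<bar>\<theta>'\<bar> \<le> K" "\<bar>y'\<bar> \<le> M" "\<bar>a\<bar> \<le> M"
  shows "\<bar>row_rhs \<kappa> \<sigma> a \<theta> y - row_rhs \<kappa> \<sigma> a \<theta>' y'\<bar>
    \<le> (2 * \<kappa> * K + \<sigma>\<^sup>2) * \<bar>y - y'\<bar> + (2 * \<kappa> * M + 2 * \<kappa> * M * K) * \<bar>\<theta> - \<theta>'\<bar>"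
proof -
  \<comment> \<open>Writing \<open>\<theta> y - \<theta>' y'\<close> as
    \<open>\<theta> (y - y') + y' (\<theta> - \<theta>')\<close> and factoring the difference of
    squares leaves \<open>y\<close> only inside \<open>y - y'\<close>.\<close>
  have "row_rhs \<kappa> \<sigma> a \<theta> y - row_rhs \<kappa> \<sigma> a \<theta>' y'
      = (2 * \<kappa> * \<theta> - \<sigma>\<^sup>2) * (y - y') + (2 * \<kappa> * y' - \<kappa> * (a * (\<theta> + \<theta>'))) * (\<theta> - \<theta>')"
    by (simp add: row_rhs_def algebra_simps power2_eq_square)
  also have "\<bar>\<dots>\<bar> \<le> \<bar>2 * \<kappa> * \<theta> - \<sigma>\<^sup>2\<bar> * \<bar>y - y'\<bar> + \<bar>2 * \<kappa> * y' - \<kappa> * (a * (\<theta> + \<theta>'))\<bar> * \<bar>\<theta> - \<theta>'\<bar>"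
    using abs_triangle_ineq[of "(2 * \<kappa> * \<theta> - \<sigma>\<^sup>2) * (y - y')"
        "(2 * \<kappa> * y' - \<kappa> * (a * (\<theta> + \<theta>'))) * (\<theta> - \<theta>')"]
    by (simp only: abs_mult)
  also have "\<dots> \<le> (2 * \<kappa> * K + \<sigma>\<^sup>2) * \<bar>y - y'\<bar> + (2 * \<kappa> * M + 2 * \<kappa> * M * K) * \<bar>\<theta> - \<theta>'\<bar>"
  proof (intro add_mono mult_right_mono)
    have "\<bar>2 * \<kappa> * \<theta>\<bar> \<le> 2 * \<kappa> * K"
      using assms by (simp add: abs_mult mult_left_mono)
    then show "\<bar>2 * \<kappa> * \<theta> - \<sigma>\<^sup>2\<bar> \<le> 2 * \<kappa> * K + \<sigma>\<^sup>2"
      using abs_triangle_ineq4[of "2 * \<kappa> * \<theta>" "\<sigma>\<^sup>2"] by simp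
    have "\<bar>2 * \<kappa> * y'\<bar> \<le> 2 * \<kappa> * M"
      using assms by (simp add: abs_mult mult_left_mono)
    moreover have "\<bar>a * (\<theta> + \<theta>')\<bar> \<le> M * (2 * K)"
      unfolding abs_mult by (rule mult_mono) (use assms in auto)
    then have "\<bar>\<kappa> * (a * (\<theta> + \<theta>'))\<bar> \<le> \<kappa> * (M * (2 * K))"
      using assms(1) by (simp only: abs_mult[of \<kappa>] abs_of_nonneg mult_left_mono)
    ultimately show "\<bar>2 * \<kappa> * y' - \<kappa> * (a * (\<theta> + \<theta>'))\<bar> \<le> 2 * \<kappa> * M + 2 * \<kappa> * M * K"
      using abs_triangle_ineq4[of "2 * \<kappa> * y'" "\<kappa> * (a * (\<theta> + \<theta>'))"] by (simp add: algebra_simps)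
  qed auto
  finally show ?thesis .
qed

subsection \<open>Convergence of the rows\<close>

lemma compact_Delta: "compact (Delta T)"
proof -
  have "Delta T = {0..T} \<times> {0..T} \<inter> {x. fst x \<le> snd x}"
    by (auto simp: Delta_def)
  moreover have "closed {x :: real \<times> real. fst x \<le> snd x}"
    by (intro closed_Collect_le continuous_intros)
  ultimately show ?thesis by (simp add: compact_Int_closed compact_Times)
qed

lemma diff_le_mesh:
  assumes "Suc j < length ts"
  shows "ts ! Suc j - ts ! j \<le> mesh ts"
proof -
  have "{ts ! Suc k - ts ! k | k. Suc k < length ts} = (\<lambda>k. ts ! Suc k - ts ! k) ` {k. Suc k < length ts}"
    by auto
  moreover have "finite {k. Suc k < length ts}"
    by (rule finite_subset[of _ "{..<length ts}"]) auto
  ultimately show ?thesis unfolding mesh_def using assms by (auto intro!: Max_ge)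
qed

text \<open>Counterpart of \<open>is_rows_deriv\<close>: both derivatives are values of
  \<open>row_rhs\<close> with the same \<open>a\<close>, so they can be subtracted and
  compared.\<close>

lemma is_solution_deriv:
  assumes sol: "is_solution T \<sigma> R \<alpha> P" and R: "0 < R" and s: "0 \<le> t" "t < s" "s < T"
  shows "(P t has_real_derivative row_rhs ((1 - R) / R) \<sigma> (\<alpha> (s - t)) (P s s) (P t s)) (at s)"
proof -
  have "(t, s) \<in> Delta T" using s by (simp add: Delta_def)
  then obtain d where d: "(P t has_real_derivative d) (at s within {t..T})"
    and eq: "d + 2 * P t s * (Theta1 P s + Theta2 R P s) + \<sigma>\<^sup>2 * P t s
          + \<alpha> (s - t) * (- (Theta1 P s)\<^sup>2 + R * (Theta2 R P s)\<^sup>2) = 0"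
    using sol unfolding is_solution_def by blast
  have "d = row_rhs ((1 - R) / R) \<sigma> (\<alpha> (s - t)) (P s s) (P t s)"
    using eq R row_rhs_Theta_iff[of R d "P t s" "P s s" \<sigma> "\<alpha> (s - t)"]
    by (simp add: Theta1_def Theta2_def)
  then show ?thesis using d at_within_cell(1)[OF s(2,3)] by simp
qed

text \<open>When \<open>\<alpha> 0 = 1\<close>, the diagonal value of this quotient is
  \<open>Theta1 P s\<close>. Its modulus of continuity measures the effect of freezing
  \<open>t\<close> at the left end of a cell in the coefficient.\<close>

lemma continuous_on_Delta_quotient:
  assumes "is_solution T \<sigma> R \<alpha> P" "continuous_on {0..} \<alpha>" "\<And>r. 0 \<le> r \<Longrightarrow> 0 < \<alpha> r"
  shows "continuous_on (Delta T) (\<lambda>(t, s). P t s / \<alpha> (s - t))"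
proof -
  have "continuous_on (Delta T) (\<lambda>x. P (fst x) (snd x))"
    using assms(1) by (simp add: is_solution_def case_prod_unfold)
  moreover have "continuous_on (Delta T) (\<lambda>x. \<alpha> (snd x - fst x))"
    by (rule continuous_on_compose2[OF assms(2)]) (auto intro!: continuous_intros simp: Delta_def)
  moreover have "\<alpha> (snd x - fst x) \<noteq> 0" if "x \<in> Delta T" for x
    using assms(3)[of "snd x - fst x"] that by (auto simp: Delta_def)
  ultimately show ?thesis by (simp add: case_prod_unfold continuous_on_divide)
qed

lemma uniformly_continuous_Delta_first:
  fixes f :: "real \<Rightarrow> real \<Rightarrow> real"
  assumes "continuous_on (Delta T) (\<lambda>(t, s). f t s)" "0 < \<epsilon>"
  obtains \<delta> where "0 < \<delta>" "\<And>t t' s. (t, s) \<in> Delta T \<Longrightarrow> (t', s) \<in> Delta T \<Longrightarrow> \<bar>t - t'\<bar> < \<delta> \<Longrightarrow>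
    \<bar>f t s - f t' s\<bar> < \<epsilon>"
proof -
  have "uniformly_continuous_on (Delta T) (\<lambda>(t, s). f t s)"
    by (rule compact_uniformly_continuous[OF assms(1) compact_Delta])
  then obtain \<delta> where "0 < \<delta>" and \<delta>: "\<And>x y. x \<in> Delta T \<Longrightarrow> y \<in> Delta T \<Longrightarrow> dist y x < \<delta> \<Longrightarrow>
    dist ((\<lambda>(t, s). f t s) y) ((\<lambda>(t, s). f t s) x) < \<epsilon>"
    using assms(2) unfolding uniformly_continuous_on_def by metis
  have "\<bar>f t s - f t' s\<bar> < \<epsilon>" if "(t, s) \<in> Delta T" "(t', s) \<in> Delta T" "\<bar>t - t'\<bar> < \<delta>" for t t' s
    using \<delta>[OF that(2,1)] that(3) by (simp add: dist_Pair_Pair dist_real_def)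
  with \<open>0 < \<delta>\<close> show ?thesis using that by blast
qed

text \<open>All constants and the barrier are fixed before the partition is chosen, so one mesh
  bound serves all partitions, rows and times.\<close>

lemma rows_converge:
  assumes T: "0 < T" and R: "0 < R" "R \<le> 1"
    and \<alpha>: "continuous_on {0..} \<alpha>" "\<And>r. 0 \<le> r \<Longrightarrow> 0 < \<alpha> r" "\<alpha> 0 = 1"
    and sol: "is_solution T \<sigma> R \<alpha> P" and \<epsilon>: "0 < \<epsilon>"
  obtains \<delta> where "0 < \<delta>"
    "\<And>ts p k s. is_partition T ts \<Longrightarrow> mesh ts < \<delta> \<Longrightarrow> is_rows T \<sigma> R \<alpha> ts p \<Longrightarrow>
      Suc k < length ts \<Longrightarrow> s \<in> {ts ! k..T} \<Longrightarrow> \<bar>p k s - P (ts ! k) s\<bar> \<le> \<epsilon>"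
proof -
  define \<kappa> where "\<kappa> = (1 - R) / R"
  have \<kappa>: "0 \<le> \<kappa>" using R by (simp add: \<kappa>_def)
  have contP: "continuous_on (Delta T) (\<lambda>(t, s). P t s)" using sol by (simp add: is_solution_def)
  have cont\<alpha>: "continuous_on {0..T} \<alpha>" by (rule continuous_on_subset[OF \<alpha>(1)]) auto
  obtain r where r: "r \<in> {0..T}" "\<And>x. x \<in> {0..T} \<Longrightarrow> \<alpha> r \<le> \<alpha> x"
    using continuous_attains_inf[OF _ _ cont\<alpha>] T by auto
  define a where "a = \<alpha> r"
  have a: "0 < a" "\<And>x. x \<in> {0..T} \<Longrightarrow> a \<le> \<alpha> x" using r \<alpha>(2) by (auto simp: a_def)
  obtain M1 where M1: "\<And>t s. (t, s) \<in> Delta T \<Longrightarrow> \<bar>P t s\<bar> \<le> M1"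
    using compact_imp_bounded[OF compact_continuous_image[OF contP compact_Delta]]
    unfolding bounded_iff by force
  obtain M2 where M2: "\<And>x. x \<in> {0..T} \<Longrightarrow> \<bar>\<alpha> x\<bar> \<le> M2"
    using compact_imp_bounded[OF compact_continuous_image[OF cont\<alpha>]]
    unfolding bounded_iff by force
  define M where "M = max M1 M2"
  have M: "\<And>t s. (t, s) \<in> Delta T \<Longrightarrow> \<bar>P t s\<bar> \<le> M" "\<And>x. x \<in> {0..T} \<Longrightarrow> \<bar>\<alpha> x\<bar> \<le> M"
    using M1 M2 unfolding M_def by (meson max.coboundedI1 max.coboundedI2)+
  have "0 \<le> M" using M(2)[of 0] T by simp
  \<comment> \<open>Bounds both coefficients: \<open>P s s\<close> by \<open>M\<close>, and the
    quotient formed from a row by \<open>(M + 1) / a\<close> as long as the error of that row is at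
    most 1.\<close>
  define K where "K = max M ((M + 1) / a)"
  define D where "D = 2 * \<kappa> * M + 2 * \<kappa> * M * K"
  \<comment> \<open>Chosen so that \<open>C b\<close> is the Lipschitz bound for the derivative when
    the row error is at most \<open>b\<close> and the coefficient error at most
    \<open>b / a + b\<close>.\<close>
  define C where "C = 2 * \<kappa> * K + \<sigma>\<^sup>2 + D * (1 / a + 1)"
  have "0 \<le> K" using \<open>0 \<le> M\<close> by (simp add: K_def)
  then have "0 \<le> D" using \<kappa> \<open>0 \<le> M\<close> by (simp add: D_def)
  then have "0 \<le> C" using \<kappa> \<open>0 \<le> K\<close> a(1) by (simp add: C_def)
  \<comment> \<open>Scaled so that the barrier is at most \<open>min \<epsilon> 1\<close> on
    \<open>{0..T}\<close>: the 1 gives the a priori bound on the rows, the \<open>\<epsilon>\<close>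
    gives the claim.\<close>
  define \<eta> where "\<eta> = min \<epsilon> 1 * exp (- (C * T))"
  have \<eta>: "0 < \<eta>" using \<epsilon> by (simp add: \<eta>_def)
  define b where "b s = \<eta> * exp (C * (T - s))" for s
  have b_le: "b s \<le> min \<epsilon> 1" if "0 \<le> s" for s
  proof -
    have "b s = min \<epsilon> 1 * exp (- (C * s))"
      by (simp add: b_def \<eta>_def algebra_simps flip: exp_add)
    also have "\<dots> \<le> min \<epsilon> 1 * 1"
      by (rule mult_left_mono) (use \<epsilon> \<open>0 \<le> C\<close> that in auto)
    finally show ?thesis by simp
  qed
  have b_ge: "\<eta> \<le> b s" if "s \<le> T" for s
    using \<eta> \<open>0 \<le> C\<close> that by (simp add: b_def)
  \<comment> \<open>The tolerance \<open>\<eta>\<close> is the least value of the barrier on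
    \<open>{0..T}\<close>, so the barrier absorbs the freezing error at every time.\<close>
  obtain \<delta> where \<delta>: "0 < \<delta>" "\<And>t t' s. (t, s) \<in> Delta T \<Longrightarrow> (t', s) \<in> Delta T \<Longrightarrow> \<bar>t - t'\<bar> < \<delta> \<Longrightarrow>
    \<bar>P t s / \<alpha> (s - t) - P t' s / \<alpha> (s - t')\<bar> < \<eta>"
    by (rule uniformly_continuous_Delta_first[OF continuous_on_Delta_quotient[OF sol \<alpha>(1,2)] \<eta>]) (assumption, rule that, blast+)
  have "\<bar>p k s - P (ts ! k) s\<bar> \<le> \<epsilon>"
    if ts: "is_partition T ts" and mesh: "mesh ts < \<delta>" and rows: "is_rows T \<sigma> R \<alpha> ts p"
      and k: "Suc k < length ts" and s: "s \<in> {ts ! k..T}" for ts p k s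
  proof -
    note ts' = is_partitionD[OF ts]
    have t0: "0 \<le> ts ! j" if "j < length ts" for j
      using sorted_nth_le[OF ts'(2), of 0 j] ts'(4) that by simp
    have "\<bar>p k s - P (ts ! k) s\<bar> < \<eta> * exp (C * (T - s))"
    \<comment> \<open>The barrier is applied to all rows at once, because the derivative of row
      \<open>k\<close> at time \<open>s\<close> involves the row whose cell contains
      \<open>s\<close>. The exceptional times are the partition points, where the coefficients
      jump.\<close>
    proof (rule exp_barrier[where e = "\<lambda>k s. p k s - P (ts ! k) s" and l = "\<lambda>k. ts ! k"
          and I = "{k. Suc k < length ts}" and S = "set ts"])
      show "finite {k. Suc k < length ts}"
        by (rule finite_subset[of _ "{..<length ts}"]) auto
      fix k assume "k \<in> {k. Suc k < length ts}"
      then have k: "Suc k < length ts" by simp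
      have tk: "0 \<le> ts ! k" "ts ! k \<le> T" using t0[of k] sorted_nth_le_last[OF ts'(2), of k] k ts'(3) by auto
      have "continuous_on {ts ! k..T} (\<lambda>s. (\<lambda>(t, s). P t s) (ts ! k, s))"
        by (rule continuous_on_compose2[OF contP])
          (use tk in \<open>auto intro!: continuous_intros simp: Delta_def\<close>)
      moreover have "continuous_on {ts ! k..T} (p k)" using rows k by (simp add: is_rows_def)
      ultimately show "continuous_on {ts ! k..T} (\<lambda>s. p k s - P (ts ! k) s)"
        by (intro continuous_intros) simp_all
      show "p k T - P (ts ! k) T = 0"
        using rows sol k tk by (simp add: is_rows_def is_solution_def)
      fix s assume s: "s \<in> {ts ! k<..<T} - set ts"
        and below: "\<And>j. j \<in> {k. Suc k < length ts} \<Longrightarrow> ts ! j \<le> s \<Longrightarrow>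
          \<bar>p j s - P (ts ! j) s\<bar> < \<eta> * exp (C * (T - s))"
      obtain j where j: "k \<le> j" "Suc j < length ts" "ts ! j \<le> s" "s < ts ! Suc j"
        by (rule sorted_cell_exists[OF ts'(1), of k s]) (use k s ts'(3) in auto)
      moreover have "s \<noteq> ts ! j" using s j by auto
      ultimately have sj: "ts ! j < s" by simp
      have tj: "0 \<le> ts ! j" using t0[of j] j by simp
      have in_Delta: "(ts ! k, s) \<in> Delta T" "(ts ! j, s) \<in> Delta T" "(s, s) \<in> Delta T"
        using tk tj s sj by (auto simp: Delta_def)
      define y where "y = P (ts ! k) s"
      define \<theta> where "\<theta> = p j s / \<alpha> (s - ts ! j)"
      define d where "d = row_rhs \<kappa> \<sigma> (\<alpha> (s - ts ! k)) \<theta> (p k s) - row_rhs \<kappa> \<sigma> (\<alpha> (s - ts ! k)) (P s s) y"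
      have "((\<lambda>s. p k s - P (ts ! k) s) has_real_derivative d) (at s)"
        unfolding d_def \<theta>_def y_def \<kappa>_def
        by (intro DERIV_diff is_rows_deriv[OF rows ts R(1) \<alpha>(2) j(1,2) sj j(4)]
            is_solution_deriv[OF sol R(1)]) (use tk s in auto)
      moreover have "\<bar>d\<bar> \<le> C * b s"
      proof -
        have e: "\<bar>p k s - y\<bar> \<le> b s" "\<bar>p j s - P (ts ! j) s\<bar> \<le> b s"
          using below[of k] below[of j] k j s unfolding b_def y_def by (auto intro: less_imp_le)
        have b1: "b s \<le> 1" using b_le[of s] tk s by simp
        have \<alpha>j: "a \<le> \<alpha> (s - ts ! j)" using a(2) tj sj s by simp
        have "\<bar>p j s\<bar> \<le> M + 1" using e(2) b1 M(1)[OF in_Delta(2)] by linarith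
        then have "\<bar>\<theta>\<bar> \<le> (M + 1) / a"
          unfolding \<theta>_def abs_divide using \<alpha>j a(1) \<open>0 \<le> M\<close> by (intro frac_le) auto
        then have \<theta>K: "\<bar>\<theta>\<bar> \<le> K" by (simp add: K_def)
        have PK: "\<bar>P s s\<bar> \<le> K" using M(1)[OF in_Delta(3)] by (simp add: K_def)
        \<comment> \<open>The first summand is the error of row \<open>j\<close> divided by
          \<alpha>, the second is the freezing error. Writing \<open>P s s\<close> as a quotient
          uses \<open>\<alpha> 0 = 1\<close>.\<close>
        have "\<theta> - P s s = (p j s - P (ts ! j) s) / \<alpha> (s - ts ! j)
            + (P (ts ! j) s / \<alpha> (s - ts ! j) - P s s / \<alpha> (s - s))"
          by (simp add: \<theta>_def \<alpha>(3) diff_divide_distrib)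
        moreover have "\<bar>(p j s - P (ts ! j) s) / \<alpha> (s - ts ! j)\<bar> \<le> b s / a"
          unfolding abs_divide using \<alpha>j a(1) e(2) by (intro frac_le) auto
        moreover have "\<bar>P (ts ! j) s / \<alpha> (s - ts ! j) - P s s / \<alpha> (s - s)\<bar> < \<eta>"
          by (rule \<delta>(2)[OF in_Delta(2,3)]) (use diff_le_mesh[OF j(2)] mesh j sj in auto)
        moreover have "\<eta> \<le> b s" using b_ge s by simp
        ultimately have \<theta>P: "\<bar>\<theta> - P s s\<bar> \<le> b s / a + b s" by linarith
        have "\<bar>d\<bar> \<le> (2 * \<kappa> * K + \<sigma>\<^sup>2) * \<bar>p k s - y\<bar> + D * \<bar>\<theta> - P s s\<bar>"
          unfolding d_def D_def
          by (rule row_rhs_diff_le[OF \<kappa> \<theta>K PK])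
            (use M(1)[OF in_Delta(1)] M(2)[of "s - ts ! k"] tk s in \<open>auto simp: y_def\<close>)
        also have "\<dots> \<le> (2 * \<kappa> * K + \<sigma>\<^sup>2) * b s + D * (b s / a + b s)"
          by (intro add_mono mult_left_mono e \<theta>P) (use \<kappa> \<open>0 \<le> K\<close> \<open>0 \<le> D\<close> in auto)
        also have "\<dots> = C * b s" by (simp add: C_def algebra_simps)
        finally show ?thesis .
      qed
      ultimately show "\<exists>d. ((\<lambda>s. p k s - P (ts ! k) s) has_real_derivative d) (at s) \<and>
          \<bar>d\<bar> \<le> C * (\<eta> * exp (C * (T - s)))"
        unfolding b_def by blast
    qed (use \<eta> k s in auto)
    also have "\<dots> \<le> \<epsilon>" using b_le[of s] t0[of k] k s by (simp add: b_def)
    finally show ?thesis by simp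
  qed
  with \<delta>(1) show ?thesis using that by blast
qed

section \<open>From the rows to uniform convergence of the functions attached to a partition\<close>

lemma is_rows_rows:
  assumes "is_partition T ts" "0 < R" "R \<le> 1"
    and "continuous_on {0..} \<alpha>" "\<And>r. 0 \<le> r \<Longrightarrow> 0 < \<alpha> r"
  shows "is_rows T \<sigma> R \<alpha> ts (rows T \<sigma> R \<alpha> ts)"
  unfolding rows_def by (rule someI_ex[OF is_rows_exists[OF assms]])

text \<open>For \<open>t\<close> in cell \<open>k\<close> the approximation is row \<open>k\<close>.
  It is close to \<open>P (ts ! k) s\<close> by convergence of the rows, and this is close to
  \<open>P t s\<close> because \<open>P\<close> is uniformly continuous and \<open>t\<close> is
  within one mesh size of \<open>ts ! k\<close>.\<close>

lemma P_part_uniform_limit: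
  assumes T: "0 < T" and R: "0 < R" "R \<le> 1"
    and \<alpha>: "continuous_on {0..} \<alpha>" "\<And>r. 0 \<le> r \<Longrightarrow> 0 < \<alpha> r" "\<alpha> 0 = 1"
    and sol: "is_solution T \<sigma> R \<alpha> P"
  shows "uniform_limit (Delta T) (\<lambda>ts (t, s). P_part T \<sigma> R \<alpha> ts t s) (\<lambda>(t, s). P t s)
    (mesh_to_zero T)"
  unfolding uniform_limit_iff
proof (intro allI impI)
  fix \<epsilon> :: real assume \<epsilon>: "0 < \<epsilon>"
  then have e2: "0 < \<epsilon> / 2" by simp
  obtain \<delta>1 where \<delta>1: "0 < \<delta>1"
    "\<And>ts p k s. is_partition T ts \<Longrightarrow> mesh ts < \<delta>1 \<Longrightarrow> is_rows T \<sigma> R \<alpha> ts p \<Longrightarrow>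
      Suc k < length ts \<Longrightarrow> s \<in> {ts ! k..T} \<Longrightarrow> \<bar>p k s - P (ts ! k) s\<bar> \<le> \<epsilon> / 2"
    by (rule rows_converge[OF T R \<alpha> sol e2]) (assumption, rule that, blast+)
  have contP: "continuous_on (Delta T) (\<lambda>(t, s). P t s)" using sol by (simp add: is_solution_def)
  obtain \<delta>2 where \<delta>2: "0 < \<delta>2" "\<And>t t' s. (t, s) \<in> Delta T \<Longrightarrow> (t', s) \<in> Delta T \<Longrightarrow>
    \<bar>t - t'\<bar> < \<delta>2 \<Longrightarrow> \<bar>P t s - P t' s\<bar> < \<epsilon> / 2"
    by (rule uniformly_continuous_Delta_first[OF contP e2]) (rule that, blast+)
  have "\<bar>P_part T \<sigma> R \<alpha> ts t s - P t s\<bar> < \<epsilon>"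
    if ts: "is_partition T ts" and mesh: "mesh ts < min \<delta>1 \<delta>2" and ts_Delta: "(t, s) \<in> Delta T" for ts t s
  proof -
    have t: "t \<in> {0..T}" "t \<le> s" "s \<le> T" using ts_Delta by (auto simp: Delta_def)
    obtain k where k: "Suc k < length ts" "t \<in> cell ts k" by (rule cell_exists[OF ts T t(1)])
    have tk: "ts ! k \<le> t" "t \<le> ts ! Suc k" using subsetD[OF cell_subset k(2)] by auto
    have "0 \<le> ts ! k"
      using sorted_nth_le[OF is_partitionD(2)[OF ts], of 0 k] is_partitionD(4)[OF ts] k by simp
    then have "(ts ! k, s) \<in> Delta T" using tk t by (simp add: Delta_def)
    then have "\<bar>P (ts ! k) s - P t s\<bar> < \<epsilon> / 2"
      by (rule \<delta>2(2)[OF _ ts_Delta]) (use diff_le_mesh[OF k(1)] mesh tk in auto)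
    moreover have "\<bar>rows T \<sigma> R \<alpha> ts k s - P (ts ! k) s\<bar> \<le> \<epsilon> / 2"
      by (rule \<delta>1(2)[OF ts _ is_rows_rows[OF ts R \<alpha>(1,2)] k(1)]) (use mesh tk t in auto)
    moreover have "P_part T \<sigma> R \<alpha> ts t s = rows T \<sigma> R \<alpha> ts k s"
      by (simp add: P_part_def P_of_rows_def cell_index_eq[OF ts k])
    ultimately show ?thesis by linarith
  qed
  then show "\<forall>\<^sub>F ts in mesh_to_zero T. \<forall>x\<in>Delta T.
      dist ((\<lambda>(t, s). P_part T \<sigma> R \<alpha> ts t s) x) ((\<lambda>(t, s). P t s) x) < \<epsilon>"
    unfolding eventually_mesh_to_zero using \<delta>1(1) \<delta>2(1)
    by (intro exI[of _ "min \<delta>1 \<delta>2"]) (auto simp: dist_real_def)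
qed

lemma Theta1_part_uniform_limit:
  assumes T: "0 < T" and R: "0 < R" "R \<le> 1"
    and \<alpha>: "continuous_on {0..} \<alpha>" "\<And>r. 0 \<le> r \<Longrightarrow> 0 < \<alpha> r" "\<alpha> 0 = 1"
    and sol: "is_solution T \<sigma> R \<alpha> P"
  shows "uniform_limit {0..T} (\<lambda>ts s. Theta1_part T \<sigma> R \<alpha> ts s) (Theta1 P) (mesh_to_zero T)"
  unfolding uniform_limit_iff
proof (intro allI impI)
  fix \<epsilon> :: real assume \<epsilon>: "0 < \<epsilon>"
  have cont\<alpha>: "continuous_on {0..T} \<alpha>" by (rule continuous_on_subset[OF \<alpha>(1)]) auto
  obtain r where r: "r \<in> {0..T}" "\<And>x. x \<in> {0..T} \<Longrightarrow> \<alpha> r \<le> \<alpha> x"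
    using continuous_attains_inf[OF _ _ cont\<alpha>] T by auto
  have a: "0 < \<alpha> r" using r \<alpha>(2) by auto
  \<comment> \<open>The row error will be divided by a value of \<alpha> that is at least the
    minimum \<open>\<alpha> r\<close>; the factor \<open>\<alpha> r\<close> in the tolerance
    compensates for this.\<close>
  have ea: "0 < \<epsilon> / 2 * \<alpha> r" and e2: "0 < \<epsilon> / 2" using \<epsilon> a by auto
  obtain \<delta>1 where \<delta>1: "0 < \<delta>1"
    "\<And>ts p k s. is_partition T ts \<Longrightarrow> mesh ts < \<delta>1 \<Longrightarrow> is_rows T \<sigma> R \<alpha> ts p \<Longrightarrow>
      Suc k < length ts \<Longrightarrow> s \<in> {ts ! k..T} \<Longrightarrow> \<bar>p k s - P (ts ! k) s\<bar> \<le> \<epsilon> / 2 * \<alpha> r"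
    by (rule rows_converge[OF T R \<alpha> sol ea]) (assumption, rule that, blast+)
  obtain \<delta>2 where \<delta>2: "0 < \<delta>2" "\<And>t t' s. (t, s) \<in> Delta T \<Longrightarrow> (t', s) \<in> Delta T \<Longrightarrow>
    \<bar>t - t'\<bar> < \<delta>2 \<Longrightarrow> \<bar>P t s / \<alpha> (s - t) - P t' s / \<alpha> (s - t')\<bar> < \<epsilon> / 2"
    by (rule uniformly_continuous_Delta_first[OF continuous_on_Delta_quotient[OF sol \<alpha>(1,2)] e2]) (assumption, rule that, blast+)
  have "\<bar>Theta1_part T \<sigma> R \<alpha> ts s - P s s\<bar> < \<epsilon>"
    if ts: "is_partition T ts" and mesh: "mesh ts < min \<delta>1 \<delta>2" and s: "s \<in> {0..T}" for ts s
  proof -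
    obtain k where k: "Suc k < length ts" "s \<in> cell ts k" by (rule cell_exists[OF ts T s])
    have sk: "ts ! k \<le> s" "s \<le> ts ! Suc k" using subsetD[OF cell_subset k(2)] by auto
    have t0: "0 \<le> ts ! k"
      using sorted_nth_le[OF is_partitionD(2)[OF ts], of 0 k] is_partitionD(4)[OF ts] k by simp
    define q where "q = rows T \<sigma> R \<alpha> ts k s"
    have "(ts ! k, s) \<in> Delta T" "(s, s) \<in> Delta T" using sk s t0 by (auto simp: Delta_def)
    then have "\<bar>P (ts ! k) s / \<alpha> (s - ts ! k) - P s s / \<alpha> (s - s)\<bar> < \<epsilon> / 2"
      by (rule \<delta>2(2)) (use diff_le_mesh[OF k(1)] mesh sk in auto)
    moreover have "\<bar>q - P (ts ! k) s\<bar> \<le> \<epsilon> / 2 * \<alpha> r"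
      unfolding q_def
      by (rule \<delta>1(2)[OF ts _ is_rows_rows[OF ts R \<alpha>(1,2)] k(1)]) (use mesh sk s in auto)
    then have "\<bar>(q - P (ts ! k) s) / \<alpha> (s - ts ! k)\<bar> \<le> \<epsilon> / 2 * \<alpha> r / \<alpha> r"
      unfolding abs_divide using a r(2)[of "s - ts ! k"] \<epsilon> sk s t0 by (intro frac_le) auto
    then have "\<bar>(q - P (ts ! k) s) / \<alpha> (s - ts ! k)\<bar> \<le> \<epsilon> / 2" using a by simp
    moreover have "Theta1_part T \<sigma> R \<alpha> ts s - P s s = (q - P (ts ! k) s) / \<alpha> (s - ts ! k)
        + (P (ts ! k) s / \<alpha> (s - ts ! k) - P s s / \<alpha> (s - s))"
      by (simp add: Theta1_part_def Theta1_of_rows_cell[OF ts k] q_def \<alpha>(3) diff_divide_distrib)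
    ultimately show ?thesis by linarith
  qed
  then show "\<forall>\<^sub>F ts in mesh_to_zero T. \<forall>s\<in>{0..T}. dist (Theta1_part T \<sigma> R \<alpha> ts s) (Theta1 P s) < \<epsilon>"
    unfolding eventually_mesh_to_zero using \<delta>1(1) \<delta>2(1)
    by (intro exI[of _ "min \<delta>1 \<delta>2"]) (auto simp: dist_real_def Theta1_def)
qed

section \<open>Application to the mixture of two exponentials\<close>

theorem theorem4:
  fixes T \<sigma> R lam \<rho> \<gamma> :: real
    and \<alpha> :: "real \<Rightarrow> real"
    and P :: "real \<Rightarrow> real \<Rightarrow> real"
  assumes "0 < T"
    and "0 < R" and "R \<le> 1"
    and "0 < \<rho>" and "\<rho> < \<gamma>"
    and "0 < lam" and "lam < 1"
    and "\<alpha> = (\<lambda>r. lam * exp (- \<rho> * r) + (1 - lam) * exp (- \<gamma> * r))"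
    and "is_solution T \<sigma> R \<alpha> P"
  shows "uniform_limit (Delta T) (\<lambda>ts (t, s). P_part T \<sigma> R \<alpha> ts t s) (\<lambda>(t, s). P t s)
           (mesh_to_zero T) \<and>
         uniform_limit {0..T} (\<lambda>ts s. Theta1_part T \<sigma> R \<alpha> ts s) (Theta1 P) (mesh_to_zero T) \<and>
         uniform_limit {0..T} (\<lambda>ts s. Theta2_part T \<sigma> R \<alpha> ts s) (Theta2 R P) (mesh_to_zero T)"
proof -
  have cont: "continuous_on {0..} \<alpha>"
    unfolding assms(8) by (intro continuous_intros)
  have pos: "0 < \<alpha> r" for r
    unfolding assms(8) by (intro add_pos_pos mult_pos_pos) (use assms(6,7) in auto)
  have one: "\<alpha> 0 = 1" by (simp add: assms(8))
  note hyps = assms(1-3) cont pos one assms(9)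
  have \<Theta>1: "uniform_limit {0..T} (\<lambda>ts s. Theta1_part T \<sigma> R \<alpha> ts s) (Theta1 P) (mesh_to_zero T)"
    by (rule Theta1_part_uniform_limit[OF hyps])
  \<comment> \<open>In both problems the second coefficient is the first one times the constant
    \<open>- 1 / R\<close>, and multiplication by a constant preserves uniform limits.\<close>
  have "Theta2_part T \<sigma> R \<alpha> = (\<lambda>ts s. - 1 / R * Theta1_part T \<sigma> R \<alpha> ts s)"
    by (simp add: fun_eq_iff Theta2_part_def Theta1_part_def Theta2_of_rows_eq)
  moreover have "Theta2 R P = (\<lambda>s. - 1 / R * Theta1 P s)"
    by (simp add: fun_eq_iff Theta2_def Theta1_def)
  ultimately have "uniform_limit {0..T} (\<lambda>ts s. Theta2_part T \<sigma> R \<alpha> ts s) (Theta2 R P) (mesh_to_zero T)"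
    using bounded_linear.uniform_limit[OF bounded_linear_mult_right \<Theta>1, of "- 1 / R"] by simp
  with \<Theta>1 P_part_uniform_limit[OF hyps] show ?thesis by blast
qed

end
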